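(* Let $n\ge1$ and let $\mathcal M=(\Theta,C,P_1,\dots,P_n)$ be a generic internally-colored $C$-set. Then $\mathcal M$ has a transitive extension which in canonical form is an internally-colored $D$-set.
   Context: **Extensions.** A one-point extension of a structure $\mathcal M$ with universe $M$ is a first-order structure $\mathcal M'$ with universe $M\cup\{0\}$, $0\notin M$, such that the stabilizer $\mathrm{Aut}(\mathcal M')_0$, acting on $M$, equals $\mathrm{Aut}(\mathcal M)$. It is a transitive extension if $\mathrm{Aut}(\mathcal M')$ is transitive on $M\cup\{0\}$. A transitive extension of a structure with relations $R_1,\dots,R_m$ is in canonical form if its language consists of relations $R_1',\dots,R_m'$, each $R_i'$ of arity one more than $R_i$, such that $R_i(\overline x)\Leftrightarrow R_i'(\overline x,0)$ for all tuples $\overline x$ from $M$ of the appropriate length. Here, up to the placement of the argument $0$, the canonical form has relations $D$ (quaternary) and $P_1',\dots,P_n'$ (ternary) on $\Theta\cup\{0\}$ with $C(x;yz)\Leftrightarrow D(0x;yz)$ and $P_i(x,y)\Leftrightarrow P_i'(x,y,0)$ for $x,y,z\in\Theta$. **$C$-sets.** A $C$-set is a set with a ternary relation $C$ satisfying, for all $a,b,c,d$: (C1) $C(a;bc)\to C(a;cb)$; (C2) $C(a;bc)\to\neg C(b;ac)$; (C3) $C(a;bc)\to C(a;dc)\vee C(d;bc)$; (C4) $a\ne b\to C(a;bb)$. (Think of leaves of a rooted tree; $C(a;bc)$ says that the path from $a$ to the root is disjoint from the path from $b$ to $c$.) Two pairs $\{a,b\},\{c,d\}$ with $a\ne b$,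 $c\ne d$ have the same branching point if none of $C(c;ab)$, $C(d;ab)$, $C(a;cd)$, $C(b;cd)$ holds. Let $\Delta^m_X$ be the set of $m$-tuples from $X$ whose entries are not all distinct. An internally-colored $C$-set (with $n$ colors) is a $C$-set $\Theta$ with binary relations $P_1,\dots,P_n$ (colors) which partition $\Theta^2\setminus\Delta^2_\Theta$, such that any two ordered pairs of distinct elements whose underlying unordered pairs have the same branching point have the same color (in particular each $P_i$ is symmetric). The generic internally-colored $C$-set is the Fraïssé limit of the class of finite internally-colored $C$-sets with $n$ colors. **$D$-sets.** A $D$-set is a set with a quaternary relation $D$ satisfying, for all $w,x,y,z$: (D1) $D(wx;yz)\to(D(xw;yz)\wedge D(yz;wx))$; (D2) $D(wx;yz)\to\neg D(wy;xz)$; (D3) $D(wx;yz)\to\forall v\,(D(vx;yz)\vee D(wx;yv))$; (D4) $(w\ne y\wedge x\ne y)\to D(wx;yy)$. A splitting of a $D$-set is a partition $\mathcal D$ of it into at least three sets (sectors) such that for every $\Sigma\in\mathcal D$, all $a,b\in\Sigma$ and all $c,d\notin\Sigma$, $D(ab;cd)$ holds, and for any $a,b,c,d$ from four distinct sectors $D(ab;cd)$ does not hold. Any three distinct points $a,b,c$ of a $D$-set lie in distinct sectors of a unique splitting, called their branching point. An internally-colored $D$-set is a $D$-set $\Omega$ with ternary relations $P_1,\dots,P_n$ which partition $\Omega^3\setminus\Delta^3_\Omega$, such that for every splitting $\mathcal D$ of $\Omega$ there is a unique $i$ such that $P_i(x,y,z)$ holds for all $x,y,z$ whose branching point is $\mathcal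 D$. *)

theory Defs
  imports Main "HOL-Library.Countable_Set" "HOL-Library.Disjoint_Sets"
    "HOL-Combinatorics.Permutations"
begin

section \<open>Relational structures\<close>

text \<open>A signature maps each relation symbol of the language to its arity; symbols mapped to
  \<^term>\<open>None\<close> are not in the language. All notions below look at \<open>rel A s\<close> only on
  \<open>tuples_of A s\<close>, i.e. on tuples from the universe of the right arity.\<close>

record ('s, 'a) struct =
  sig :: "'s \<rightharpoonup> nat"
  univ :: "'a set"
  rel :: "'s \<Rightarrow> 'a list \<Rightarrow> bool"

definition tuples_of :: "('s, 'a) struct \<Rightarrow> 's \<Rightarrow> 'a list set" where
  "tuples_of A s = {xs. set xs \<subseteq> univ A \<and> sig A s = Some (length xs)}"

definition embedding :: "('a \<Rightarrow> 'b) \<Rightarrow> ('s, 'a) struct \<Rightarrow> ('s, 'b) struct \<Rightarrow> bool" where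
  "embedding f A B \<longleftrightarrow> sig A = sig B \<and> inj_on f (univ A) \<and> f ` univ A \<subseteq> univ B \<and>
     (\<forall>s. \<forall>xs \<in> tuples_of A s. rel A s xs \<longleftrightarrow> rel B s (map f xs))"

definition substruct :: "('s, 'a) struct \<Rightarrow> 'a set \<Rightarrow> ('s, 'a) struct" where
  "substruct M X = M\<lparr>univ := X\<rparr>"

text \<open>Automorphisms are the identity outside the universe (by \<open>permutes\<close>), so that equality of
  automorphism groups is equality of sets of functions.\<close>

definition Aut :: "('s, 'a) struct \<Rightarrow> ('a \<Rightarrow> 'a) set" where
  "Aut M = {g. g permutes univ M \<and>
     (\<forall>s. \<forall>xs \<in> tuples_of M s. rel M s (map g xs) \<longleftrightarrow> rel M s xs)}"

definition ultrahomogeneous :: "('s, 'a) struct \<Rightarrow> bool" where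
  "ultrahomogeneous M \<longleftrightarrow>
     (\<forall>X f. X \<subseteq> univ M \<and> finite X \<and> embedding f (substruct M X) M \<longrightarrow>
        (\<exists>g \<in> Aut M. \<forall>x \<in> X. g x = f x))"

text \<open>Finite structures are represented, up to isomorphism, with universes in \<^typ>\<open>nat\<close>.\<close>

definition age :: "('s, 'a) struct \<Rightarrow> ('s, nat) struct set" where
  "age M = {A. finite (univ A) \<and> (\<exists>f. embedding f A M)}"

definition fraisse_limit :: "('s, nat) struct set \<Rightarrow> ('s, 'a) struct \<Rightarrow> bool" where
  "fraisse_limit K M \<longleftrightarrow> countable (univ M) \<and> ultrahomogeneous M \<and> age M = K"


section \<open>Extensions\<close>

text \<open>The new point \<open>0\<close> is \<^term>\<open>None\<close>, and \<open>x\<close> in the universe of \<open>M\<close> is identified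
  with \<open>Some x\<close>. Under this identification \<open>map_option g\<close> is the permutation fixing
  \<open>0\<close> and acting as \<open>g\<close> on the universe of \<open>M\<close>. The language of the extension is
  unrelated to that of \<open>M\<close>.\<close>

definition one_point_extension :: "('s, 'a) struct \<Rightarrow> ('t, 'a option) struct \<Rightarrow> bool" where
  "one_point_extension M M' \<longleftrightarrow> univ M' = insert None (Some ` univ M) \<and>
     {g \<in> Aut M'. g None = None} = map_option ` Aut M"

definition transitive_extension :: "('s, 'a) struct \<Rightarrow> ('t, 'a option) struct \<Rightarrow> bool" where
  "transitive_extension M M' \<longleftrightarrow> one_point_extension M M' \<and>
     (\<forall>x \<in> univ M'. \<forall>y \<in> univ M'. \<exists>g \<in> Aut M'. g x = y)"

text \<open>The relation \<open>R'\<close> corresponding to \<open>R\<close> is named by the same symbol \<open>s\<close>; the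
  argument \<open>0\<close> is inserted with \<open>pos s\<close> arguments before it.\<close>

definition insert_at :: "nat \<Rightarrow> 'a \<Rightarrow> 'a list \<Rightarrow> 'a list" where
  "insert_at p z xs = take p xs @ z # drop p xs"

definition canonical_form ::
  "('s \<Rightarrow> nat) \<Rightarrow> ('s, 'a) struct \<Rightarrow> ('s, 'a option) struct \<Rightarrow> bool" where
  "canonical_form pos M M' \<longleftrightarrow> (\<forall>s. sig M' s = map_option Suc (sig M s)) \<and>
     (\<forall>s. \<forall>xs \<in> tuples_of M s.
        rel M s xs \<longleftrightarrow> rel M' s (insert_at (pos s) None (map Some xs)))"


section \<open>Internally colored \<open>C\<close>-sets\<close>

text \<open>\<open>Tree\<close> names the relation \<open>C\<close> of a \<open>C\<close>-set and \<open>D\<close> of a \<open>D\<close>-set.\<close>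

datatype sym = Tree | Color nat

text \<open>Color classes may be empty.\<close>

definition colors_partition :: "nat \<Rightarrow> nat \<Rightarrow> (sym, 'a) struct \<Rightarrow> bool" where
  "colors_partition n m M \<longleftrightarrow>
     (\<forall>xs. set xs \<subseteq> univ M \<and> length xs = m \<longrightarrow>
        (if distinct xs then \<exists>!i. i \<in> {1..n} \<and> rel M (Color i) xs
         else \<forall>i \<in> {1..n}. \<not> rel M (Color i) xs))"

definition C_set :: "'a set \<Rightarrow> ('a \<Rightarrow> 'a \<Rightarrow> 'a \<Rightarrow> bool) \<Rightarrow> bool" where
  "C_set \<Theta> C \<longleftrightarrow> (\<forall>a\<in>\<Theta>. \<forall>b\<in>\<Theta>. \<forall>c\<in>\<Theta>. \<forall>d\<in>\<Theta>.
     (C a b c \<longrightarrow> C a c b) \<and>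
     (C a b c \<longrightarrow> \<not> C b a c) \<and>
     (C a b c \<longrightarrow> C a d c \<or> C d b c) \<and>
     (a \<noteq> b \<longrightarrow> C a b b))"

definition same_branching_point ::
  "('a \<Rightarrow> 'a \<Rightarrow> 'a \<Rightarrow> bool) \<Rightarrow> 'a \<Rightarrow> 'a \<Rightarrow> 'a \<Rightarrow> 'a \<Rightarrow> bool" where
  "same_branching_point C a b c d \<longleftrightarrow> a \<noteq> b \<and> c \<noteq> d \<and>
     \<not> C c a b \<and> \<not> C d a b \<and> \<not> C a c d \<and> \<not> C b c d"

definition C_rel :: "(sym, 'a) struct \<Rightarrow> 'a \<Rightarrow> 'a \<Rightarrow> 'a \<Rightarrow> bool" where
  "C_rel M x y z \<longleftrightarrow> rel M Tree [x, y, z]"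

definition C_sig :: "nat \<Rightarrow> sym \<rightharpoonup> nat" where
  "C_sig n s = (case s of Tree \<Rightarrow> Some 3 | Color i \<Rightarrow> if i \<in> {1..n} then Some 2 else None)"

definition internally_colored_C_set :: "nat \<Rightarrow> (sym, 'a) struct \<Rightarrow> bool" where
  "internally_colored_C_set n M \<longleftrightarrow> sig M = C_sig n \<and> C_set (univ M) (C_rel M) \<and>
     colors_partition n 2 M \<and>
     (\<forall>a\<in>univ M. \<forall>b\<in>univ M. \<forall>c\<in>univ M. \<forall>d\<in>univ M. same_branching_point (C_rel M) a b c d \<longrightarrow>
        (\<forall>i\<in>{1..n}. rel M (Color i) [a, b] \<longleftrightarrow> rel M (Color i) [c, d]))"

definition generic_internally_colored_C_set :: "nat \<Rightarrow> (sym, 'a) struct \<Rightarrow> bool" where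
  "generic_internally_colored_C_set n M \<longleftrightarrow>
     fraisse_limit {A. finite (univ A) \<and> internally_colored_C_set n A} M"


section \<open>Internally colored \<open>D\<close>-sets\<close>

definition D_set :: "'a set \<Rightarrow> ('a \<Rightarrow> 'a \<Rightarrow> 'a \<Rightarrow> 'a \<Rightarrow> bool) \<Rightarrow> bool" where
  "D_set \<Omega> D \<longleftrightarrow> (\<forall>w\<in>\<Omega>. \<forall>x\<in>\<Omega>. \<forall>y\<in>\<Omega>. \<forall>z\<in>\<Omega>.
     (D w x y z \<longrightarrow> D x w y z \<and> D y z w x) \<and>
     (D w x y z \<longrightarrow> \<not> D w y x z) \<and>
     (D w x y z \<longrightarrow> (\<forall>v\<in>\<Omega>. D v x y z \<or> D w x y v)) \<and>
     (w \<noteq> y \<and> x \<noteq> y \<longrightarrow> D w x y y))"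

definition splitting ::
  "'a set \<Rightarrow> ('a \<Rightarrow> 'a \<Rightarrow> 'a \<Rightarrow> 'a \<Rightarrow> bool) \<Rightarrow> 'a set set \<Rightarrow> bool" where
  "splitting \<Omega> D \<D> \<longleftrightarrow> partition_on \<Omega> \<D> \<and> (infinite \<D> \<or> 3 \<le> card \<D>) \<and>
     (\<forall>\<Sigma>\<in>\<D>. \<forall>a\<in>\<Sigma>. \<forall>b\<in>\<Sigma>. \<forall>c\<in>\<Omega> - \<Sigma>. \<forall>d\<in>\<Omega> - \<Sigma>. D a b c d) \<and>
     (\<forall>A\<in>\<D>. \<forall>B\<in>\<D>. \<forall>C\<in>\<D>. \<forall>E\<in>\<D>. distinct [A, B, C, E] \<longrightarrow>
        (\<forall>a\<in>A. \<forall>b\<in>B. \<forall>c\<in>C. \<forall>d\<in>E. \<not> D a b c d))"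

text \<open>Stated as a relation between \<open>\<D>\<close> and \<open>a\<close>, \<open>b\<close>, \<open>c\<close>: for distinct points of a
  \<open>D\<close>-set exactly one such \<open>\<D>\<close> exists.\<close>

definition is_branching_point ::
  "'a set \<Rightarrow> ('a \<Rightarrow> 'a \<Rightarrow> 'a \<Rightarrow> 'a \<Rightarrow> bool) \<Rightarrow> 'a set set \<Rightarrow> 'a \<Rightarrow> 'a \<Rightarrow> 'a \<Rightarrow> bool" where
  "is_branching_point \<Omega> D \<D> a b c \<longleftrightarrow> splitting \<Omega> D \<D> \<and>
     (\<exists>A\<in>\<D>. \<exists>B\<in>\<D>. \<exists>C\<in>\<D>. distinct [A, B, C] \<and> a \<in> A \<and> b \<in> B \<and> c \<in> C)"

definition D_rel :: "(sym, 'a) struct \<Rightarrow> 'a \<Rightarrow> 'a \<Rightarrow> 'a \<Rightarrow> 'a \<Rightarrow> bool" where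
  "D_rel M w x y z \<longleftrightarrow> rel M Tree [w, x, y, z]"

definition D_sig :: "nat \<Rightarrow> sym \<rightharpoonup> nat" where
  "D_sig n s = (case s of Tree \<Rightarrow> Some 4 | Color i \<Rightarrow> if i \<in> {1..n} then Some 3 else None)"

definition internally_colored_D_set :: "nat \<Rightarrow> (sym, 'a) struct \<Rightarrow> bool" where
  "internally_colored_D_set n M \<longleftrightarrow> sig M = D_sig n \<and> D_set (univ M) (D_rel M) \<and>
     colors_partition n 3 M \<and>
     (\<forall>\<D>. splitting (univ M) (D_rel M) \<D> \<longrightarrow>
        (\<exists>!i. i \<in> {1..n} \<and>
           (\<forall>x y z. is_branching_point (univ M) (D_rel M) \<D> x y z \<longrightarrow> rel M (Color i) [x, y, z])))"

text \<open>The placement of \<open>0\<close>: \<open>C(x;yz)\<close> iff \<open>D(0x;yz)\<close>, and \<open>P\<^sub>i(x,y)\<close> iff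
  \<open>P\<^sub>i'(x,y,0)\<close>.\<close>

definition zero_pos :: "sym \<Rightarrow> nat" where
  "zero_pos s = (case s of Tree \<Rightarrow> 0 | Color i \<Rightarrow> 2)"

end

theory Submission
  imports Defs
begin

text \<open>The new point is attached as an extra leaf at the root of the tree of \<^term>\<open>M\<close>, and the
  root is then forgotten: this gives a \<open>D\<close>-set in which a triple carries the color of its
  branching point, namely of the lowest of its pairwise meets. Re-rooting this \<open>D\<close>-set
  at any point \<open>o\<close> yields an internally colored \<open>C\<close>-set again. Hence, if a finite partial
  isomorphism sends \<open>o\<close> to the new point, the extension property of \<^term>\<open>M\<close>, applied to the
  structure re-rooted at \<open>o\<close>, enlarges its domain by any given point. Finite partial isomorphisms with
  the new point both in the domain and in the range therefore have the back-and-forth property, and one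
  of them moves the new point to any prescribed \<open>x\<close>: take the partial isomorphism \<open>{(x, new)}\<close>,
  enlarge its domain by the new point, and invert.\<close>

section \<open>Trees without a root\<close>

text \<open>The extension property of \<open>M\<close> speaks of rooted trees only. A partial
  isomorphism of the extension can therefore be enlarged by it only if some point is sent to the new
  point; this is why the back-and-forth carries the new point along on both sides instead of running
  through all finite partial isomorphisms. Besides symmetry, the colors obey one four-point law,
  \<open>t_exchange\<close>: the medians of a, b, c and of a, b, d agree unless the quartet pairs
  \<open>a\<close> with \<open>c\<close> or \<open>a\<close> with \<open>d\<close>. This law serves
  both for re-rooting (\<open>t_same_base\<close>) and for the color condition on splittings
  (\<open>t_splitting\<close>), so no splitting ever has to be constructed from a triple. The
  stabilizer of the new point is the automorphism group of \<open>M\<close> because each structure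
  is definable from the other once the new point is named.\<close>

locale colored_D =
  fixes D :: "'b \<Rightarrow> 'b \<Rightarrow> 'b \<Rightarrow> 'b \<Rightarrow> bool" and t :: "'b \<Rightarrow> 'b \<Rightarrow> 'b \<Rightarrow> 'k"
  assumes D_swap: "D w x y z \<Longrightarrow> D x w y z"
    and D_sym: "D w x y z \<Longrightarrow> D y z w x"
    and D_excl: "D w x y z \<Longrightarrow> \<not> D w y x z"
    and D_point: "D w x y z \<Longrightarrow> D v x y z \<or> D w x y v"
    and D_refl: "w \<noteq> y \<Longrightarrow> x \<noteq> y \<Longrightarrow> D w x y y"
    and t_swap12: "distinct [a, b, c] \<Longrightarrow> t a b c = t b a c"
    and t_swap23: "distinct [a, b, c] \<Longrightarrow> t a b c = t a c b"
    and t_exchange: "distinct [a, b, c] \<Longrightarrow> distinct [a, b, d] \<Longrightarrow>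
      \<not> D a c b d \<Longrightarrow> \<not> D a d b c \<Longrightarrow> t a b c = t a b d"
begin

lemma D_swap_iff: "D w x y z \<longleftrightarrow> D x w y z"
  using D_swap by blast

lemma D_swap2_iff: "D w x y z \<longleftrightarrow> D w x z y"
  using D_swap D_sym by blast

text \<open>Together with \<open>not_D_base\<close> this settles, by equality alone, every tuple in
  which the base point occurs again; comparisons through a base may then be restricted to tuples
  avoiding it.\<close>

lemma D_base_eq: "D o' o' y z \<longleftrightarrow> y \<noteq> o' \<and> z \<noteq> o'"
  using D_excl[of o' o' y z] D_excl[of o' o' z y] D_refl[of y o' z] D_sym D_swap2_iff by blast

lemma not_D_base: "\<not> D o' w o' z"
  using D_excl[of o' w o' z] D_base_eq[of o' w z] D_base_eq[of o' o' w] D_base_eq[of o' o' z]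
    D_sym[of o' w o' o'] by blast

text \<open>Left to right, (D3) lets \<open>o'\<close> replace a point of one pair or a point of the
  other, and the four choices combine to the disjunction. Right to left, failure of
  \<open>D w x y z\<close> would give both \<open>D o' w y x\<close> and \<open>D o' x y w\<close>,
  against (D2). The right side is the formula that later defines \<open>D_of\<close> from a rooted
  relation.\<close>

lemma D_by_base:
  "D w x y z \<longleftrightarrow> (D o' w y z \<and> D o' x y z) \<or> (D o' y w x \<and> D o' z w x)"
proof
  assume *: "D w x y z"
  have "D o' x y z \<or> D o' y w x" "D o' w y z \<or> D o' y w x"
    "D o' x y z \<or> D o' z w x" "D o' w y z \<or> D o' z w x"
    using D_point[of w x y z o'] D_point[of x w y z o'] D_point[of w x z y o'] D_point[of x w z y o']
      * D_swap_iff D_swap2_iff D_sym by blast+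
  then show "(D o' w y z \<and> D o' x y z) \<or> (D o' y w x \<and> D o' z w x)" by blast
next
  have *: "D w x y z" if "D o' w y z" "D o' x y z" for w x y z
    using D_point[OF that(1), of x] D_point[OF that(2), of w] D_excl[of o' x w y]
      D_swap_iff[of x w] D_swap2_iff[of o' x y w] D_swap2_iff[of o' w y x] by blast
  assume "(D o' w y z \<and> D o' x y z) \<or> (D o' y w x \<and> D o' z w x)"
  then show "D w x y z" using * D_sym by blast
qed

text \<open>A point on the side of \<open>o'\<close> can be exchanged for \<open>o'\<close> without
  moving the median; if neither \<open>a\<close> nor \<open>b\<close> is such a point,
  \<open>c\<close> is exchanged. The right side is the formula of \<open>median_col\<close> for the
  coloring of pairs by \<open>t a b o'\<close>.\<close>

lemma t_by_base:
  assumes "distinct [a, b, c, o']"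
  shows "t a b c = (if D o' a b c then t b c o' else if D o' b a c then t a c o' else t a b o')"
proof -
  have "t a b c = t b c a" using assms t_swap12[of a b c] t_swap23[of b a c] by auto
  moreover have "t a b c = t a c b" using assms t_swap23[of a b c] by simp
  moreover have "t b c a = t b c o'" if "D o' a b c"
    using assms that by (intro t_exchange) (auto dest: D_excl D_swap D_sym)
  moreover have "t a c b = t a c o'" if "D o' b a c"
    using assms that by (intro t_exchange) (auto dest: D_excl D_swap D_sym)
  moreover have "t a b c = t a b o'" if "\<not> D o' b a c" "\<not> D o' a b c"
    using assms that by (intro t_exchange) (auto dest: D_excl D_swap D_sym)
  ultimately show ?thesis by auto
qed

text \<open>One endpoint is replaced at a time, from a, b to b, c to c, d, and
  \<open>t_exchange\<close> keeps the color. The middle pair meets at the same node if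
  \<open>a\<close> is not split off from \<open>b\<close> and \<open>c\<close>; otherwise (D2) says
  that \<open>b\<close> is not split off from \<open>a\<close> and \<open>c\<close>, and
  \<open>a\<close> and \<open>b\<close> change roles.\<close>

lemma t_same_base:
  assumes "o' \<notin> {a, b, c, d}" and sb: "same_branching_point (D o') a b c d"
  shows "t a b o' = t c d o'"
proof -
  have *: "t a b o' = t c d o'" if sb: "same_branching_point (D o') a b c d"
    and o: "o' \<notin> {a, b, c, d}" and n: "\<not> D o' a b c" for a b c d
  proof -
    have ne: "a \<noteq> b" "c \<noteq> d" and "\<not> D o' c a b" "\<not> D o' d a b" "\<not> D o' a c d" "\<not> D o' b c d"
      using sb by (auto simp: same_branching_point_def)
    have bc: "b \<noteq> c" using n o ne D_refl by auto
    have "t b o' a = t b o' c"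
      using ne bc o n \<open>\<not> D o' c a b\<close> by (intro t_exchange) (auto dest: D_swap D_sym)
    moreover have "\<not> D o' d c b"
      using n \<open>\<not> D o' d a b\<close> D_point[of o' d b c a] by (metis D_swap D_sym D_point)
    then have "t c o' b = t c o' d"
      using ne bc o \<open>\<not> D o' b c d\<close> by (intro t_exchange) (auto dest: D_swap D_sym)
    ultimately show ?thesis using ne bc o t_swap12 t_swap23
      by (smt (verit) distinct_length_2_or_more distinct_singleton insert_iff)
  qed
  show ?thesis
  proof (cases "D o' a b c")
    case True
    then have "\<not> D o' b a c" by (simp add: D_excl)
    moreover have "same_branching_point (D o') b a c d"
      using sb D_swap2_iff by (auto simp: same_branching_point_def)
    ultimately have "t b a o' = t c d o'" using * assms by auto
    moreover have "t a b o' = t b a o'"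
      using assms by (intro t_swap12) (auto simp: same_branching_point_def)
    ultimately show ?thesis by simp
  qed (use * assms in blast)
qed

text \<open>An exchange argument: \<open>x\<close>, \<open>y\<close>, \<open>z\<close> are brought
  in one after the other, each replacing an old point such that the two points kept lie outside the
  sector of the new one.\<close>

lemma t_splitting:
  assumes "splitting \<Omega> D \<D>" and "is_branching_point \<Omega> D \<D> a b c" and "is_branching_point \<Omega> D \<D> x y z"
  shows "t a b c = t x y z"
proof -
  define ap where "ap x y \<longleftrightarrow> (\<forall>A\<in>\<D>. \<not> (x \<in> A \<and> y \<in> A)) \<and> x \<in> \<Omega> \<and> y \<in> \<Omega>" for x y
  have part: "partition_on \<Omega> \<D>" using assms(1) by (simp add: splitting_def)
  have uniq: "A = B" if "A \<in> \<D>" "B \<in> \<D>" "x \<in> A" "x \<in> B" for A B x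
    using part that by (auto simp: partition_on_def disjoint_def)
  have cover: "\<exists>A\<in>\<D>. x \<in> A" if "x \<in> \<Omega>" for x
    using part that by (auto simp: partition_on_def)
  have apI: "ap x y" if "A \<in> \<D>" "B \<in> \<D>" "A \<noteq> B" "x \<in> A" "y \<in> B" for A B x y
    using that uniq[of A _ x] uniq[of B _ y] partition_onD1[OF part] unfolding ap_def by blast
  have branch: "ap a b \<and> ap a c \<and> ap b c" if "is_branching_point \<Omega> D \<D> a b c" for a b c
    using that apI by (auto simp: is_branching_point_def)
  have ap_sym: "ap x y \<Longrightarrow> ap y x" for x y by (auto simp: ap_def)
  have ap_neq: "ap x y \<Longrightarrow> x \<noteq> y" for x y
    using cover by (auto simp: ap_def)
  \<comment> \<open>A point has a single sector, so it can share it with at most one of two points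
    that are apart. Hence \<open>x\<close> is apart from at least two of \<open>a\<close>,
    \<open>b\<close>, \<open>c\<close>.\<close>
  have ap_trans: "ap x y \<or> ap x z" if "x \<in> \<Omega>" "ap y z" for x y z
    using that uniq unfolding ap_def by metis
  have step: "t a b c = t a b d" if "ap a b" "ap a c" "ap b c" "ap a d" "ap b d" for a b c d
  proof -
    have "a \<in> \<Omega>" "b \<in> \<Omega>" "c \<in> \<Omega>" "d \<in> \<Omega>" using that by (simp_all add: ap_def)
    then obtain A B C E where S: "A \<in> \<D>" "B \<in> \<D>" "C \<in> \<D>" "E \<in> \<D>" "a \<in> A" "b \<in> B" "c \<in> C" "d \<in> E"
      using cover by metis
    have neq: "X \<noteq> Y" if "ap x y" "x \<in> X" "y \<in> Y" "X \<in> \<D>" for x y X Y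
      using that unfolding ap_def by blast
    have ne: "distinct [A, B, C]" "distinct [A, B, E]" using neq that S by simp_all
    \<comment> \<open>If \<open>c\<close> and \<open>d\<close> share a sector, then
      \<open>D c d a b\<close> holds and excludes the other pairings; otherwise the four points lie
      in distinct sectors and no pairing holds.\<close>
    have "\<not> D a c b d \<and> \<not> D a d b c"
    proof (cases "C = E")
      case True
      then have "a \<notin> C" "b \<notin> C" using S ne uniq by (metis distinct_length_2_or_more)+
      then have "D c d a b" "D d c a b"
        using assms(1) S True \<open>a \<in> \<Omega>\<close> \<open>b \<in> \<Omega>\<close> unfolding splitting_def by blast+
      then show ?thesis
        using D_excl[of c d a b] D_excl[of d c a b] D_swap_iff[of a c b d] D_swap_iff[of a d b c]
          D_swap2_iff[of c a b d] D_swap2_iff[of d a b c] by blast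
    next
      case False
      then have "distinct [A, C, B, E]" "distinct [A, E, B, C]" using ne by auto
      then show ?thesis using assms(1) S unfolding splitting_def by metis
    qed
    then show ?thesis using that ap_neq by (intro t_exchange) auto
  qed
  have perm: "t b a c = t a b c \<and> t a c b = t a b c" if "ap a b" "ap a c" "ap b c" for a b c
    using t_swap12[of a b c] t_swap23[of a b c] that ap_neq by simp
  have abc: "ap a b" "ap a c" "ap b c" and xyz: "ap x y" "ap x z" "ap y z"
    using branch assms by blast+
  then have "x \<in> \<Omega>" "y \<in> \<Omega>" by (auto simp: ap_def)
  obtain p q where pq: "ap p q" "ap x p" "ap x q" "t a b c = t x p q"
  proof -
    have "(ap x b \<and> ap x c) \<or> (ap x a \<and> ap x c) \<or> (ap x a \<and> ap x b)"
      using ap_trans[OF \<open>x \<in> \<Omega>\<close>] abc by blast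
    then consider "ap x b" "ap x c" | "ap x a" "ap x c" | "ap x a" "ap x b" by blast
    then show ?thesis
    proof cases
      case 1
      then show ?thesis using step[of b c a x] perm abc that ap_sym by metis
    next
      case 2
      then show ?thesis using step[of a c b x] perm abc that ap_sym by metis
    next
      case 3
      then show ?thesis using step[of a b c x] perm abc that ap_sym by metis
    qed
  qed
  obtain q' where q: "ap x q'" "ap y q'" "t a b c = t x y q'"
  proof (cases "ap y q")
    case True
    then show ?thesis using step[of x q p y] perm pq xyz that ap_sym by metis
  next
    case False
    then have "ap y p" using ap_trans[OF \<open>y \<in> \<Omega>\<close>] pq by blast
    then show ?thesis using step[of x p q y] perm pq xyz that ap_sym by metis
  qed
  then show ?thesis using step[of x y q' z] xyz by simp
qed

end

section \<open>Forgetting the root of a colored tree\<close>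

locale colored_C =
  fixes C :: "'b \<Rightarrow> 'b \<Rightarrow> 'b \<Rightarrow> bool" and col :: "'b \<Rightarrow> 'b \<Rightarrow> 'k"
  assumes C_set_UNIV: "C_set UNIV C"
    and col_branch: "same_branching_point C a b c d \<Longrightarrow> col a b = col c d"
begin

text \<open>The paths from \<open>w\<close> to \<open>x\<close> and from \<open>y\<close> to
  \<open>z\<close> are disjoint exactly when both ends of one path avoid the cone at the meet of the
  other two points.\<close>

definition D_of :: "'b \<Rightarrow> 'b \<Rightarrow> 'b \<Rightarrow> 'b \<Rightarrow> bool" where
  "D_of w x y z \<longleftrightarrow> (C w y z \<and> C x y z) \<or> (C y w x \<and> C z w x)"

text \<open>At least two of the three pairwise meets agree, and the third one lies below them or agrees with
  them too.\<close>

definition median_col :: "'b \<Rightarrow> 'b \<Rightarrow> 'b \<Rightarrow> 'k" where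
  "median_col a b c = (if C a b c then col b c else if C b a c then col a c else col a b)"

lemma C1: "C a b c \<Longrightarrow> C a c b" and C2: "C a b c \<Longrightarrow> \<not> C b a c"
  and C3: "C a b c \<Longrightarrow> C a d c \<or> C d b c" and C4: "a \<noteq> b \<Longrightarrow> C a b b"
  using C_set_UNIV unfolding C_set_def by blast+

lemma C1_iff: "C a b c \<longleftrightarrow> C a c b"
  using C1 by blast

lemma C_irrefl: "\<not> C a a b" "\<not> C a b a"
  using C2[of a a b] C1[of a b a] by blast+

lemma col_commute: "a \<noteq> b \<Longrightarrow> col a b = col b a"
  by (rule col_branch) (simp add: same_branching_point_def C_irrefl)

lemma D_of_swap: "D_of w x y z \<Longrightarrow> D_of x w y z"
  unfolding D_of_def using C1[of y w x] C1[of z w x] by blast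

lemma D_of_sym: "D_of w x y z \<Longrightarrow> D_of y z w x"
  unfolding D_of_def by blast

lemma D_of_excl: "D_of w x y z \<Longrightarrow> \<not> D_of w y x z"
  unfolding D_of_def using C2[of x y z] C2[of w z y] C2[of z w x] C2[of y x w]
    C1_iff[of w y z] C1_iff[of z w y] C1_iff[of w x z] C1_iff[of x w y] C1_iff[of y w x] by blast

lemma D_of_point: "D_of w x y z \<Longrightarrow> D_of v x y z \<or> D_of w x y v"
  unfolding D_of_def
  using C3[of w y z v] C3[of x y z v] C3[of w z y v] C3[of x z y v] C3[of y w x v] C3[of z w x v]
    C1_iff[of w y z] C1_iff[of x y z] C1_iff[of v y z]
    C1_iff[of w v y] C1_iff[of x v y] by blast

lemma col_exchange:
  assumes "a \<noteq> b" "a \<noteq> c" "\<not> C b a c" "\<not> C c a b"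
  shows "col a b = col a c"
  using assms by (intro col_branch) (auto simp: same_branching_point_def C_irrefl)

text \<open>Either the same one of \<open>a\<close> and \<open>b\<close> is split off in both
  triples, and then the remaining pairs meet at the same node, or neither is split off in either
  triple, and then both sides are \<open>col a b\<close>.\<close>

lemma median_col_exchange:
  assumes "distinct [a, b, c]" "distinct [a, b, d]" "\<not> D_of a c b d" "\<not> D_of a d b c"
  shows "median_col a b c = median_col a b d"
proof -
  have *: "C a b d \<and> col b c = col b d"
    if "C a b c" "\<not> D_of a c b d" "\<not> D_of a d b c" "b \<noteq> c" "b \<noteq> d" for a b c d
  proof -
    have "\<not> C d b c" using that by (auto simp: D_of_def)
    then have "C a b d" using that(1) C1_iff[of a] C1_iff[of d] C3[of a c b d] C3[of a b c d] by blast
    then have "\<not> C c b d" using that by (auto simp: D_of_def)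
    then show ?thesis using that \<open>C a b d\<close> \<open>\<not> C d b c\<close> col_exchange by blast
  qed
  have ab: "\<not> D_of b c a d" "\<not> D_of b d a c" using assms D_of_swap D_of_sym by blast+
  show ?thesis
    using *[of a b c d] *[of a b d c] *[of b a c d] *[of b a d c] assms ab C2[of a b c] C2[of a b d]
    unfolding median_col_def by (smt (verit) distinct_length_2_or_more)
qed

text \<open>From here on any point can serve as base \<open>o'\<close>, which is what re-rooting
  needs.\<close>

sublocale colored_D D_of median_col
proof
  show "median_col a b c = median_col b a c" if "distinct [a, b, c]" for a b c
    using that col_commute[of a b] C2[of a b c] by (simp add: median_col_def)
  show "median_col a b c = median_col a c b" if "distinct [a, b, c]" for a b c
    using that col_commute[of b c] col_exchange[of a b c] C2[of a b c] C2[of b c a] C1[of a b c]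
      C1[of a c b] C1[of b a c] C1[of c a b]
    by (auto simp: median_col_def)
  show "D_of w x y y" if "w \<noteq> y" "x \<noteq> y" for w x y
    using that by (simp add: D_of_def C4)
next
  show "D_of x w y z" if "D_of w x y z" for w x y z using that by (rule D_of_swap)
next
  show "D_of y z w x" if "D_of w x y z" for w x y z using that by (rule D_of_sym)
next
  show "\<not> D_of w y x z" if "D_of w x y z" for w x y z using that by (rule D_of_excl)
next
  show "D_of v x y z \<or> D_of w x y v" if "D_of w x y z" for w x y z v using that by (rule D_of_point)
next
  show "median_col a b c = median_col a b d"
    if "distinct [a, b, c]" "distinct [a, b, d]" "\<not> D_of a c b d" "\<not> D_of a d b c" for a b c d
    using that by (rule median_col_exchange)
qed
end

section \<open>The extension property of the generic structure\<close>

lemma sig_substruct [simp]: "sig (substruct M X) = sig M"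
  and univ_substruct [simp]: "univ (substruct M X) = X"
  and rel_substruct [simp]: "rel (substruct M X) = rel M"
  by (simp_all add: substruct_def)

section \<open>Embeddings between relational structures\<close>

lemma embedding_sig: "embedding f A B \<Longrightarrow> sig A = sig B"
  and embedding_inj: "embedding f A B \<Longrightarrow> inj_on f (univ A)"
  and embedding_range: "embedding f A B \<Longrightarrow> f ` univ A \<subseteq> univ B"
  by (simp_all add: embedding_def)

lemma embedding_rel:
  assumes "embedding f A B" "set xs \<subseteq> univ A" "sig A s = Some (length xs)"
  shows "rel B s (map f xs) \<longleftrightarrow> rel A s xs"
  using assms by (simp add: embedding_def tuples_of_def)

lemma embeddingI:
  assumes "sig A = sig B" "inj_on f (univ A)" "f ` univ A \<subseteq> univ B"
    and "\<And>s xs. set xs \<subseteq> univ A \<Longrightarrow> sig A s = Some (length xs) \<Longrightarrow> rel B s (map f xs) \<longleftrightarrow> rel A s xs"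
  shows "embedding f A B"
  using assms by (simp add: embedding_def tuples_of_def)

lemma embedding_comp:
  assumes "embedding f A B" "embedding g B C"
  shows "embedding (g \<circ> f) A C"
proof (rule embeddingI)
  show "sig A = sig C" using assms by (simp add: embedding_sig)
  show "inj_on (g \<circ> f) (univ A)"
    using assms by (meson comp_inj_on embedding_inj embedding_range inj_on_subset)
  show "(g \<circ> f) ` univ A \<subseteq> univ C"
    using assms embedding_range[of f A B] embedding_range[of g B C] by (auto simp: image_subset_iff)
  fix s xs assume xs: "set xs \<subseteq> univ A" "sig A s = Some (length xs)"
  have "set (map f xs) \<subseteq> univ B" using xs embedding_range[OF assms(1)] by auto
  then have "rel C s (map g (map f xs)) = rel B s (map f xs)"
    using xs assms by (intro embedding_rel) (auto simp: embedding_sig)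
  then show "rel C s (map (g \<circ> f) xs) = rel A s xs"
    using embedding_rel[OF assms(1) xs] by simp
qed

lemma embedding_cong:
  assumes "embedding f A B" "\<And>x. x \<in> univ A \<Longrightarrow> f x = g x"
  shows "embedding g A B"
proof (rule embeddingI)
  fix s xs assume xs: "set xs \<subseteq> univ A" "sig A s = Some (length xs)"
  then have "map g xs = map f xs" using assms(2) by auto
  then show "rel B s (map g xs) = rel A s xs" using embedding_rel[OF assms(1) xs] by (simp only:)
next
  show "inj_on g (univ A)" using embedding_inj[OF assms(1)] assms(2) inj_on_cong by metis
  show "g ` univ A \<subseteq> univ B" using embedding_range[OF assms(1)] assms(2) by auto
qed (rule embedding_sig[OF assms(1)])

lemma embedding_substruct:
  assumes "embedding f A B" "X \<subseteq> univ A"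
  shows "embedding f (substruct A X) B"
proof (rule embeddingI)
  fix s xs assume "set xs \<subseteq> univ (substruct A X)" "sig (substruct A X) s = Some (length xs)"
  then show "rel B s (map f xs) = rel (substruct A X) s xs"
    using embedding_rel[OF assms(1), of xs s] assms(2) by auto
next
  show "inj_on f (univ (substruct A X))"
    using embedding_inj[OF assms(1)] assms(2) by (simp add: inj_on_subset)
  show "f ` univ (substruct A X) \<subseteq> univ B"
    using embedding_range[OF assms(1)] assms(2) by auto
qed (use embedding_sig[OF assms(1)] in simp)

lemma embedding_inv:
  assumes "embedding f A B"
  shows "embedding (inv_into (univ A) f) (substruct B (f ` univ A)) A"
proof (rule embeddingI)
  show "sig (substruct B (f ` univ A)) = sig A" using assms by (simp add: embedding_sig)
  show "inj_on (inv_into (univ A) f) (univ (substruct B (f ` univ A)))"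
    by (simp add: inj_on_inv_into)
  show "inv_into (univ A) f ` univ (substruct B (f ` univ A)) \<subseteq> univ A"
    by (auto intro: inv_into_into)
  fix s xs assume xs: "set xs \<subseteq> univ (substruct B (f ` univ A))"
    "sig (substruct B (f ` univ A)) s = Some (length xs)"
  define ys where "ys = map (inv_into (univ A) f) xs"
  have "map f ys = xs" using xs by (auto simp: ys_def f_inv_into_f intro!: map_idI)
  moreover have "set ys \<subseteq> univ A" using xs by (auto simp: ys_def intro: inv_into_into)
  ultimately show "rel A s (map (inv_into (univ A) f) xs) = rel (substruct B (f ` univ A)) s xs"
    using embedding_rel[OF assms, of ys s] xs assms by (auto simp: ys_def embedding_sig)
qed

text \<open>\<open>age\<close> consists of structures on \<open>nat\<close>, whereas the finite
  structures to be compared with it live on other types, such as subsets of \<open>M\<close> or of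
  the extension.\<close>

lemma finite_struct_nat_copy:
  assumes "finite (univ B)"
  obtains A :: "('s, nat) struct" and e where "finite (univ A)" "embedding e (B :: ('s, 'b) struct) A"
    "e ` univ B = univ A"
proof -
  obtain e :: "'b \<Rightarrow> nat" where e: "inj_on e (univ B)"
    using finite_imp_inj_to_nat_seg[OF assms] by auto
  define A where "A = \<lparr>sig = sig B, univ = e ` univ B, rel = \<lambda>s xs. rel B s (map (inv_into (univ B) e) xs)\<rparr>"
  have "embedding e B A"
  proof (rule embeddingI)
    fix s xs assume xs: "set xs \<subseteq> univ B"
    have "map (inv_into (univ B) e) (map e xs) = xs"
      using xs e by (auto intro!: map_idI)
    then show "rel A s (map e xs) = rel B s xs" by (simp only: A_def struct.simps)
  qed (use e in \<open>auto simp: A_def\<close>)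
  moreover have "finite (univ A)" "e ` univ B = univ A" using assms by (simp_all add: A_def)
  ultimately show thesis using that by blast
qed

lemma colors_partition_2:
  "colors_partition n 2 M \<longleftrightarrow> (\<forall>x\<in>univ M. \<forall>y\<in>univ M.
     if x \<noteq> y then \<exists>!i. i \<in> {1..n} \<and> rel M (Color i) [x, y]
     else \<forall>i\<in>{1..n}. \<not> rel M (Color i) [x, y])" (is "?L \<longleftrightarrow> ?R")
proof
  assume L: ?L
  show ?R
  proof (intro ballI)
    fix x y assume "x \<in> univ M" "y \<in> univ M"
    then show "if x \<noteq> y then \<exists>!i. i \<in> {1..n} \<and> rel M (Color i) [x, y]
     else \<forall>i\<in>{1..n}. \<not> rel M (Color i) [x, y]"
      using L[unfolded colors_partition_def, THEN spec, of "[x, y]"]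
      by (simp only: distinct_length_2_or_more distinct_singleton simp_thms) simp
  qed
next
  assume R: ?R
  show ?L unfolding colors_partition_def
  proof (intro allI impI)
    fix xs assume xs: "set xs \<subseteq> univ M \<and> length xs = 2"
    then obtain x y where "xs = [x, y]" by (metis length_0_conv length_Suc_conv numeral_2_eq_2)
    moreover from this have xy: "x \<in> univ M" "y \<in> univ M" using xs by auto
    ultimately show "if distinct xs then \<exists>!i. i \<in> {1..n} \<and> rel M (Color i) xs
      else \<forall>i\<in>{1..n}. \<not> rel M (Color i) xs"
      using bspec[OF bspec[OF R xy(1)] xy(2)]
      by (simp only: distinct_length_2_or_more distinct_singleton simp_thms)
  qed
qed

lemma C_sig_simps [simp]: "C_sig n Tree = Some 3" "i \<in> {1..n} \<Longrightarrow> C_sig n (Color i) = Some 2"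
  by (simp_all add: C_sig_def)

text \<open>The axioms are universal in the points, the only existential quantifier ranging over the
  fixed finite set of colors, so they pull back along embeddings.\<close>

lemma internally_colored_C_set_embedding:
  assumes f: "embedding f A B" and B: "internally_colored_C_set n B"
  shows "internally_colored_C_set n A"
proof -
  have sig: "sig A = C_sig n" using f B by (simp add: internally_colored_C_set_def embedding_sig)
  have C: "C_rel A x y z \<longleftrightarrow> C_rel B (f x) (f y) (f z)"
    if "x \<in> univ A" "y \<in> univ A" "z \<in> univ A" for x y z
    using embedding_rel[OF f, of "[x, y, z]" Tree] that sig by (simp add: C_rel_def)
  have P: "rel A (Color i) [x, y] \<longleftrightarrow> rel B (Color i) [f x, f y]"
    if "x \<in> univ A" "y \<in> univ A" "i \<in> {1..n}" for x y i
    using embedding_rel[OF f, of "[x, y]" "Color i"] that sig by simp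
  have fin: "f x \<in> univ B" if "x \<in> univ A" for x
    using embedding_range[OF f] that by auto
  have inj: "f x = f y \<longleftrightarrow> x = y" if "x \<in> univ A" "y \<in> univ A" for x y
    using embedding_inj[OF f] that by (auto simp: inj_on_def)
  have "C_set (univ B) (C_rel B)" using B by (simp add: internally_colored_C_set_def)
  then have "C_set (univ A) (C_rel A)"
    unfolding C_set_def
  proof (intro ballI)
    fix a b c d assume A: "a \<in> univ A" "b \<in> univ A" "c \<in> univ A" "d \<in> univ A"
    have B: "\<forall>a\<in>univ B. \<forall>b\<in>univ B. \<forall>c\<in>univ B. \<forall>d\<in>univ B.
      (C_rel B a b c \<longrightarrow> C_rel B a c b) \<and> (C_rel B a b c \<longrightarrow> \<not> C_rel B b a c) \<and>
      (C_rel B a b c \<longrightarrow> C_rel B a d c \<or> C_rel B d b c) \<and> (a \<noteq> b \<longrightarrow> C_rel B a b b)"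
      using \<open>C_set (univ B) (C_rel B)\<close> by (simp only: C_set_def)
    from bspec[OF bspec[OF bspec[OF bspec[OF B fin[OF A(1)]] fin[OF A(2)]] fin[OF A(3)]] fin[OF A(4)]]
    show "(C_rel A a b c \<longrightarrow> C_rel A a c b) \<and> (C_rel A a b c \<longrightarrow> \<not> C_rel A b a c) \<and>
      (C_rel A a b c \<longrightarrow> C_rel A a d c \<or> C_rel A d b c) \<and> (a \<noteq> b \<longrightarrow> C_rel A a b b)"
      by (simp only: C inj A)
  qed
  moreover have "colors_partition n 2 A"
    unfolding colors_partition_2
  proof (intro ballI)
    fix x y assume xy: "x \<in> univ A" "y \<in> univ A"
    have "if f x \<noteq> f y then \<exists>!i. i \<in> {1..n} \<and> rel B (Color i) [f x, f y]
      else \<forall>i\<in>{1..n}. \<not> rel B (Color i) [f x, f y]"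
      using B fin xy unfolding internally_colored_C_set_def colors_partition_2 by blast
    moreover have "(i \<in> {1..n} \<and> rel A (Color i) [x, y]) \<longleftrightarrow> (i \<in> {1..n} \<and> rel B (Color i) [f x, f y])" for i
      using P[OF xy] by blast
    ultimately show "if x \<noteq> y then \<exists>!i. i \<in> {1..n} \<and> rel A (Color i) [x, y]
      else \<forall>i\<in>{1..n}. \<not> rel A (Color i) [x, y]"
      by (auto simp only: inj[OF xy] P[OF xy] split: if_splits)
  qed
  moreover have "rel A (Color i) [a, b] \<longleftrightarrow> rel A (Color i) [c, d]"
    if "a \<in> univ A" "b \<in> univ A" "c \<in> univ A" "d \<in> univ A" "same_branching_point (C_rel A) a b c d"
      "i \<in> {1..n}" for a b c d i
  proof -
    have "same_branching_point (C_rel B) (f a) (f b) (f c) (f d)"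
      using that by (simp add: same_branching_point_def C inj)
    then have "rel B (Color i) [f a, f b] \<longleftrightarrow> rel B (Color i) [f c, f d]"
      using B that(6) fin[OF that(1)] fin[OF that(2)] fin[OF that(3)] fin[OF that(4)]
      unfolding internally_colored_C_set_def by simp
    then show ?thesis using P that by simp
  qed
  ultimately show ?thesis using sig unfolding internally_colored_C_set_def by (intro conjI ballI impI) simp_all
qed

text \<open>Every axiom of internally colored \<open>C\<close>-sets mentions at most four points.\<close>

lemma internally_colored_C_set_local:
  assumes "sig M = C_sig n"
    and loc: "\<And>X. X \<subseteq> univ M \<Longrightarrow> finite X \<Longrightarrow> internally_colored_C_set n (substruct M X)"
  shows "internally_colored_C_set n M"
proof -
  have *: "internally_colored_C_set n (substruct M {a, b, c, d})"
    if "a \<in> univ M" "b \<in> univ M" "c \<in> univ M" "d \<in> univ M" for a b c d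
    using loc[of "{a, b, c, d}"] that by simp
  have Crel: "C_rel (substruct M X) = C_rel M" for X by (simp add: C_rel_def fun_eq_iff)
  show ?thesis unfolding internally_colored_C_set_def
  proof (intro conjI ballI impI)
    show "C_set (univ M) (C_rel M)"
      unfolding C_set_def
    proof (intro ballI)
      fix a b c d assume "a \<in> univ M" "b \<in> univ M" "c \<in> univ M" "d \<in> univ M"
      from *[OF this] have "C_set {a, b, c, d} (C_rel M)"
        by (simp add: internally_colored_C_set_def Crel)
      then show "(C_rel M a b c \<longrightarrow> C_rel M a c b) \<and> (C_rel M a b c \<longrightarrow> \<not> C_rel M b a c) \<and>
        (C_rel M a b c \<longrightarrow> C_rel M a d c \<or> C_rel M d b c) \<and> (a \<noteq> b \<longrightarrow> C_rel M a b b)"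
        unfolding C_set_def by blast
    qed
    show "colors_partition n 2 M"
      unfolding colors_partition_2
    proof (intro ballI)
      fix x y assume "x \<in> univ M" "y \<in> univ M"
      then have "colors_partition n 2 (substruct M {x, y})"
        using *[of x y x y] by (simp add: internally_colored_C_set_def insert_commute)
      then show "if x \<noteq> y then \<exists>!i. i \<in> {1..n} \<and> rel M (Color i) [x, y]
        else \<forall>i\<in>{1..n}. \<not> rel M (Color i) [x, y]"
        unfolding colors_partition_2 univ_substruct rel_substruct by blast
    qed
    fix a b c d i assume x: "a \<in> univ M" "b \<in> univ M" "c \<in> univ M" "d \<in> univ M"
      and y: "same_branching_point (C_rel M) a b c d" "i \<in> {1..n}"
    from *[OF x] y show "rel M (Color i) [a, b] = rel M (Color i) [c, d]"
      unfolding internally_colored_C_set_def Crel univ_substruct rel_substruct by blast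
  qed (rule assms(1))
qed

section \<open>The generic structure and its extension property\<close>

lemma fraisse_limit_age: "fraisse_limit K M \<Longrightarrow> A \<in> K \<longleftrightarrow> finite (univ A) \<and> (\<exists>f. embedding f A M)"
  by (auto simp: fraisse_limit_def age_def)

text \<open>By locality only finite substructures matter, and their copies on \<open>nat\<close>
  belong to the age, which is the class of finite internally colored C-sets.\<close>

lemma generic_internally_colored_C_set:
  assumes "generic_internally_colored_C_set n M"
  shows "internally_colored_C_set n M"
proof -
  note K = fraisse_limit_age[OF assms[unfolded generic_internally_colored_C_set_def], simplified]
  \<comment> \<open>The signature of \<open>M\<close> is read off from the empty structure, which
    belongs to the class and hence embeds into \<open>M\<close>.\<close>
  define E :: "(sym, nat) struct" where "E = \<lparr>sig = C_sig n, univ = {}, rel = \<lambda>_ _. False\<rparr>"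
  have "internally_colored_C_set n E"
    by (simp add: internally_colored_C_set_def E_def C_set_def colors_partition_2)
  then have "sig M = C_sig n" using K[of E] embedding_sig[of _ E M] by (auto simp: E_def)
  then show ?thesis
  proof (rule internally_colored_C_set_local)
    fix X assume X: "X \<subseteq> univ M" "finite X"
    then obtain A :: "(sym, nat) struct" and e where A: "finite (univ A)" "embedding e (substruct M X) A"
      "e ` X = univ A" using finite_struct_nat_copy[of "substruct M X"] by (metis univ_substruct)
    have "embedding (inv_into X e) (substruct A (e ` X)) (substruct M X)"
      using embedding_inv[OF A(2)] by simp
    moreover have "substruct A (e ` X) = A" by (simp add: A substruct_def)
    moreover have "embedding id (substruct M X) M"
      using X by (intro embeddingI) auto
    ultimately have "\<exists>f. embedding f A M" using embedding_comp by metis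
    then have "internally_colored_C_set n A" using A K by blast
    then show "internally_colored_C_set n (substruct M X)"
      using A(2) internally_colored_C_set_embedding by blast
  qed
qed

lemma Aut_iff:
  "g \<in> Aut M \<longleftrightarrow> g permutes univ M \<and> embedding g M M"
proof -
  have "inj_on g (univ M) \<and> g ` univ M \<subseteq> univ M" if "g permutes univ M"
    using that by (simp add: permutes_inj_on permutes_image)
  then show ?thesis by (auto simp: embedding_def Aut_def)
qed

lemma ultrahomogeneousD:
  assumes "ultrahomogeneous M" "X \<subseteq> univ M" "finite X" "embedding f (substruct M X) M"
  obtains g where "g \<in> Aut M" "\<And>x. x \<in> X \<Longrightarrow> g x = f x"
  using assms unfolding ultrahomogeneous_def by metis

text \<open>The age provides some embedding of \<open>B\<close>; ultrahomogeneity provides an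
  automorphism correcting it so that it agrees with \<open>f\<close> on \<open>Y\<close>.\<close>

lemma generic_extension:
  assumes M: "generic_internally_colored_C_set n M"
    and B: "internally_colored_C_set n B" "finite (univ B)"
    and f: "Y \<subseteq> univ B" "embedding f (substruct B Y) M"
  obtains g where "embedding g B M" "\<And>y. y \<in> Y \<Longrightarrow> g y = f y"
proof -
  have lim: "fraisse_limit {A. finite (univ A) \<and> internally_colored_C_set n A} M"
    using M by (simp add: generic_internally_colored_C_set_def)
  obtain A :: "(sym, nat) struct" and e where A: "finite (univ A)" "embedding e B A" "e ` univ B = univ A"
    using finite_struct_nat_copy[OF B(2)] by metis
  have "embedding (inv_into (univ B) e) A B"
  proof -
    have "substruct A (e ` univ B) = A" by (simp add: A substruct_def)
    then show ?thesis using embedding_inv[OF A(2)] by simp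
  qed
  then have "internally_colored_C_set n A" using B internally_colored_C_set_embedding by blast
  then obtain k where "embedding k A M" using fraisse_limit_age[OF lim, of A] A(1) by blast
  then have h: "embedding (k \<circ> e) B M" (is "embedding ?h B M") using A embedding_comp by blast
  define X where "X = ?h ` Y"
  have X: "X \<subseteq> univ M" "finite X"
    using embedding_range[OF h] f(1) B(2) by (auto simp: X_def intro: finite_subset)
  have "embedding (inv_into Y ?h) (substruct M X) (substruct B Y)"
    using embedding_inv[OF embedding_substruct[OF h f(1)]] by (simp add: X_def)
  then have "embedding (f \<circ> inv_into Y ?h) (substruct M X) M"
    using f embedding_comp by blast
  moreover have "ultrahomogeneous M" using lim by (simp add: fraisse_limit_def)
  ultimately obtain g where g: "g \<in> Aut M" "\<And>x. x \<in> X \<Longrightarrow> g x = (f \<circ> inv_into Y ?h) x"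
    using X ultrahomogeneousD by blast
  have "g (?h y) = f y" if "y \<in> Y" for y
  proof -
    have "inv_into Y ?h (?h y) = y"
      using that embedding_inj[OF h] f(1) by (meson inj_on_subset inv_into_f_f)
    then show ?thesis using g(2)[of "?h y"] that by (simp add: X_def)
  qed
  moreover have "embedding (g \<circ> ?h) B M" using embedding_comp[OF h] g(1) unfolding Aut_iff by blast
  ultimately show thesis using that by simp
qed

text \<open>\<open>U\<close> is the union of an increasing chain of good relations. The last clause
  transfers to \<open>U\<close> every property that, like being a partial isomorphism, is tested on
  finitely many pairs at a time.\<close>

lemma back_and_forth:
  assumes "countable \<Omega>" "\<Omega> \<noteq> {}" "G R\<^sub>0"
    and forward: "\<And>R x. G R \<Longrightarrow> x \<in> \<Omega> \<Longrightarrow> \<exists>y. G (insert (x, y) R)"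
    and backward: "\<And>R y. G R \<Longrightarrow> y \<in> \<Omega> \<Longrightarrow> \<exists>x. G (insert (x, y) R)"
  obtains U where "R\<^sub>0 \<subseteq> U" "\<Omega> \<subseteq> Domain U" "\<Omega> \<subseteq> Range U"
    "\<And>F. finite F \<Longrightarrow> F \<subseteq> U \<Longrightarrow> \<exists>R. G R \<and> F \<subseteq> R"
proof -
  define e where "e = from_nat_into \<Omega>"
  have e: "range e = \<Omega>" "e k \<in> \<Omega>" for k
    using assms by (auto simp: e_def range_from_nat_into from_nat_into)
  \<comment> \<open>The clause for \<open>k = 0\<close> pins down the start of the chain, which
    dependent choice would otherwise leave open.\<close>
  have "\<exists>S. \<forall>k. (G (S k) \<and> (k = 0 \<longrightarrow> S k = R\<^sub>0)) \<and>
     (S k \<subseteq> S (Suc k) \<and> e k \<in> Domain (S (Suc k)) \<and> e k \<in> Range (S (Suc k)))"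
  proof (rule dependent_nat_choice)
    fix R and k :: nat assume "G R \<and> (k = 0 \<longrightarrow> R = R\<^sub>0)"
    then obtain y where "G (insert (e k, y) R)" using forward e by blast
    then obtain x where "G (insert (x, e k) (insert (e k, y) R))" using backward e by blast
    then show "\<exists>S. (G S \<and> (Suc k = 0 \<longrightarrow> S = R\<^sub>0)) \<and> R \<subseteq> S \<and> e k \<in> Domain S \<and> e k \<in> Range S"
      by (intro exI[of _ "insert (x, e k) (insert (e k, y) R)"]) auto
  qed (use assms in auto)
  then obtain S where *: "\<forall>k. (G (S k) \<and> (k = 0 \<longrightarrow> S k = R\<^sub>0)) \<and>
     (S k \<subseteq> S (Suc k) \<and> e k \<in> Domain (S (Suc k)) \<and> e k \<in> Range (S (Suc k)))" ..
  then have S: "G (S k)" "S 0 = R\<^sub>0" "S k \<subseteq> S (Suc k)"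
    "e k \<in> Domain (S (Suc k))" "e k \<in> Range (S (Suc k))" for k by blast+
  have mono: "S j \<subseteq> S k" if "j \<le> k" for j k
    using lift_Suc_mono_le[of S, OF S(3) that] .
  show thesis
  proof
    show "R\<^sub>0 \<subseteq> (\<Union>k. S k)" using S(2) by blast
    show "\<Omega> \<subseteq> Domain (\<Union>k. S k)" "\<Omega> \<subseteq> Range (\<Union>k. S k)"
      using e(1) S(4,5) by blast+
    fix F assume "finite F" "F \<subseteq> (\<Union>k. S k)"
    then have "\<exists>k. F \<subseteq> S k"
    proof (induction F)
      case (insert p F)
      then obtain j k where "F \<subseteq> S j" "p \<in> S k" by auto
      then have "insert p F \<subseteq> S (max j k)" using mono[of j "max j k"] mono[of k "max j k"] by auto
      then show ?case by blast
    qed simp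
    then show "\<exists>R. G R \<and> F \<subseteq> R" using S(1) by blast
  qed
qed

lemma Aut_comp: "g \<in> Aut M \<Longrightarrow> h \<in> Aut M \<Longrightarrow> g \<circ> h \<in> Aut M"
  by (simp add: Aut_iff permutes_compose embedding_comp[where B = M])

lemma Aut_inv:
  assumes "g \<in> Aut M"
  shows "inv g \<in> Aut M"
proof -
  have g: "g permutes univ M" "embedding g M M" using assms by (simp_all add: Aut_iff)
  have "embedding (inv_into (univ M) g) (substruct M (univ M)) M"
    using embedding_inv[OF g(2)] permutes_image[OF g(1)] by simp
  moreover have "inv_into (univ M) g x = inv g x" if "x \<in> univ M" for x
    using g(1) that by (metis inv_into_f_f permutes_inj_on permutes_inverses(1) permutes_inv permutes_in_image)
  moreover have "substruct M (univ M) = M" by (simp add: substruct_def)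
  ultimately have "embedding (inv g) M M" by (metis embedding_cong)
  then show ?thesis using g by (simp add: Aut_iff permutes_inv)
qed

section \<open>The extension by a leaf at the root\<close>

definition leaf :: "('s, 'a) struct \<Rightarrow> 'a option \<Rightarrow> bool" where
  "leaf M a \<longleftrightarrow> a \<in> Some ` univ M"

lemma leaf_simps [simp]: "leaf M (Some x) \<longleftrightarrow> x \<in> univ M" "\<not> leaf M None"
  by (auto simp: leaf_def)

text \<open>\<^term>\<open>None\<close>, and likewise every other point that is not a leaf of \<^term>\<open>M\<close>, is attached
  directly at the root. Thus the axioms hold on the whole type and need not be relativized to a
  carrier. The color 0 is reserved for pairs meeting at the root.\<close>

definition rooted_C :: "(sym, 'a) struct \<Rightarrow> 'a option \<Rightarrow> 'a option \<Rightarrow> 'a option \<Rightarrow> bool" where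
  "rooted_C M a b c \<longleftrightarrow> a \<noteq> b \<and> b = c \<or>
     leaf M b \<and> leaf M c \<and> (leaf M a \<longrightarrow> C_rel M (the a) (the b) (the c))"

definition rooted_color :: "nat \<Rightarrow> (sym, 'a) struct \<Rightarrow> 'a option \<Rightarrow> 'a option \<Rightarrow> nat" where
  "rooted_color n M a b = (if leaf M a \<and> leaf M b
     then THE i. i \<in> {1..n} \<and> rel M (Color i) [the a, the b] else 0)"

text \<open>Colors come from a total function on triples; \<open>distinct xs\<close> cuts it down to
  the triples that have a branching point.\<close>

definition D_extension :: "nat \<Rightarrow> (sym, 'a) struct \<Rightarrow> (sym, 'a option) struct" where
  "D_extension n M = \<lparr>sig = D_sig n, univ = insert None (Some ` univ M),
     rel = \<lambda>s xs. case s of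
       Tree \<Rightarrow> colored_C.D_of (rooted_C M) (xs ! 0) (xs ! 1) (xs ! 2) (xs ! 3)
     | Color i \<Rightarrow> distinct xs \<and>
         colored_C.median_col (rooted_C M) (rooted_color n M) (xs ! 0) (xs ! 1) (xs ! 2) = i\<rparr>"

lemma C_sig_Some: "C_sig n s = Some k \<longleftrightarrow> s = Tree \<and> k = 3 \<or> (\<exists>i\<in>{1..n}. s = Color i \<and> k = 2)"
  by (cases s) (auto simp: C_sig_def)

lemma D_sig_Some: "D_sig n s = Some k \<longleftrightarrow> s = Tree \<and> k = 4 \<or> (\<exists>i\<in>{1..n}. s = Color i \<and> k = 3)"
  by (cases s) (auto simp: D_sig_def)

lemma length_2_iff: "length xs = 2 \<longleftrightarrow> (\<exists>x y. xs = [x, y])"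
  and length_3_iff: "length xs = 3 \<longleftrightarrow> (\<exists>x y z. xs = [x, y, z])"
  and length_4_iff: "length xs = 4 \<longleftrightarrow> (\<exists>w x y z. xs = [w, x, y, z])"
  by (auto simp: numeral_eq_Suc length_Suc_conv)

lemma embedding_C_I:
  assumes "sig A = C_sig n" "sig B = C_sig n" "inj_on f (univ A)" "f ` univ A \<subseteq> univ B"
    and "\<And>x y z. x \<in> univ A \<Longrightarrow> y \<in> univ A \<Longrightarrow> z \<in> univ A \<Longrightarrow> C_rel B (f x) (f y) (f z) \<longleftrightarrow> C_rel A x y z"
    and "\<And>x y i. x \<in> univ A \<Longrightarrow> y \<in> univ A \<Longrightarrow> i \<in> {1..n} \<Longrightarrow>
      rel B (Color i) [f x, f y] \<longleftrightarrow> rel A (Color i) [x, y]"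
  shows "embedding f A B"
proof (rule embeddingI)
  fix s xs assume xs: "set xs \<subseteq> univ A" "sig A s = Some (length xs)"
  then consider "s = Tree" "length xs = 3" | i where "i \<in> {1..n}" "s = Color i" "length xs = 2"
    using assms(1) by (auto simp: C_sig_Some)
  then show "rel B s (map f xs) \<longleftrightarrow> rel A s xs"
  proof cases
    case 1
    then obtain x y z where "xs = [x, y, z]" by (auto simp: length_3_iff)
    then show ?thesis using 1 xs assms(5)[of x y z] by (simp add: C_rel_def)
  next
    case 2
    then obtain x y where "xs = [x, y]" by (auto simp: length_2_iff)
    then show ?thesis using 2 xs assms(6)[of x y i] by simp
  qed
qed (use assms in simp_all)

section \<open>The rooted tree over the generic structure\<close>

locale generic_C_set =
  fixes n :: nat and M :: "(sym, 'a) struct"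
  assumes generic: "generic_internally_colored_C_set n M"
begin

lemma internally_colored: "internally_colored_C_set n M"
  using generic by (rule generic_internally_colored_C_set)

lemma sig_M: "sig M = C_sig n"
  and C_set_M: "C_set (univ M) (C_rel M)"
  and colors_M: "colors_partition n 2 M"
  using internally_colored by (simp_all add: internally_colored_C_set_def)

lemma countable_M: "countable (univ M)"
  using generic by (simp add: generic_internally_colored_C_set_def fraisse_limit_def)

lemma color_unique:
  assumes "x \<in> univ M" "y \<in> univ M" "x \<noteq> y"
  shows "\<exists>!i. i \<in> {1..n} \<and> rel M (Color i) [x, y]"
  using bspec[OF bspec[OF colors_M[unfolded colors_partition_2] assms(1)] assms(2)] assms(3)
  by (simp only: if_True not_False_eq_True)

lemma not_color_same: "x \<in> univ M \<Longrightarrow> i \<in> {1..n} \<Longrightarrow> \<not> rel M (Color i) [x, x]"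
  using colors_M by (simp add: colors_partition_2)

lemma rooted_color_Some:
  assumes "x \<in> univ M" "y \<in> univ M" "x \<noteq> y"
  shows "rooted_color n M (Some x) (Some y) \<in> {1..n}"
    and "i \<in> {1..n} \<Longrightarrow> rooted_color n M (Some x) (Some y) = i \<longleftrightarrow> rel M (Color i) [x, y]"
proof -
  have "rooted_color n M (Some x) (Some y) = (THE i. i \<in> {1..n} \<and> rel M (Color i) [x, y])"
    using assms by (simp add: rooted_color_def leaf_def)
  with theI'[OF color_unique[OF assms]]
  have *: "rooted_color n M (Some x) (Some y) \<in> {1..n} \<and>
    rel M (Color (rooted_color n M (Some x) (Some y))) [x, y]" by simp
  then show "rooted_color n M (Some x) (Some y) \<in> {1..n}" by blast
  show "i \<in> {1..n} \<Longrightarrow> rooted_color n M (Some x) (Some y) = i \<longleftrightarrow> rel M (Color i) [x, y]"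
    using * color_unique[OF assms] by blast
qed

lemma C_set_rooted: "C_set UNIV (rooted_C M)"
proof -
  have C1: "C_rel M x y z \<Longrightarrow> C_rel M x z y"
    and C2: "C_rel M x y z \<Longrightarrow> \<not> C_rel M y x z"
    if "x \<in> univ M" "y \<in> univ M" "z \<in> univ M" for x y z
    using C_set_M that unfolding C_set_def by blast+
  have C3: "C_rel M x y z \<Longrightarrow> C_rel M x w z \<or> C_rel M w y z"
    if "x \<in> univ M" "y \<in> univ M" "z \<in> univ M" "w \<in> univ M" for x y z w
    using C_set_M that unfolding C_set_def by blast
  have lf: "the a \<in> univ M" if "leaf M a" for a using that by (auto simp: leaf_def)
  show ?thesis unfolding C_set_def
  proof (intro ballI conjI impI)
    fix a b c d
    show "rooted_C M a b b" if "a \<noteq> b" using that by (simp add: rooted_C_def)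
    assume abc: "rooted_C M a b c"
    show "rooted_C M a c b"
      using abc C1 lf unfolding rooted_C_def by blast
    show "\<not> rooted_C M b a c"
      using abc C1[of "the a" "the b" "the a"] C1[of "the b" "the a" "the b"] C2[of "the a" "the b" "the c"]
        C2[of "the a" "the a" "the b"] C2[of "the b" "the b" "the a"] lf
      unfolding rooted_C_def by blast
    show "rooted_C M a d c \<or> rooted_C M d b c"
      using abc C3[of "the a" "the b" "the c" "the d"] lf unfolding rooted_C_def by blast
  qed
qed

lemma rooted_color_branch:
  assumes "same_branching_point (rooted_C M) a b c d"
  shows "rooted_color n M a b = rooted_color n M c d"
proof -
  have ne: "a \<noteq> b" "c \<noteq> d" and not_C: "\<not> rooted_C M c a b" "\<not> rooted_C M d a b" "\<not> rooted_C M a c d" "\<not> rooted_C M b c d"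
    using assms by (simp_all add: same_branching_point_def)
  show ?thesis
  proof (cases "leaf M a \<and> leaf M b \<and> leaf M c \<and> leaf M d")
    case True
    then obtain w x y z where L: "a = Some w" "b = Some x" "c = Some y" "d = Some z"
      and U: "w \<in> univ M" "x \<in> univ M" "y \<in> univ M" "z \<in> univ M" by (auto simp: leaf_def)
    then have "same_branching_point (C_rel M) w x y z"
      using ne not_C True by (simp add: same_branching_point_def rooted_C_def)
    then have "rel M (Color i) [w, x] \<longleftrightarrow> rel M (Color i) [y, z]" if "i \<in> {1..n}" for i
      using internally_colored U that unfolding internally_colored_C_set_def by simp
    then have "(\<lambda>i. i \<in> {1..n} \<and> rel M (Color i) [w, x]) = (\<lambda>i. i \<in> {1..n} \<and> rel M (Color i) [y, z])"
      by blast
    then show ?thesis using True by (simp only: rooted_color_def L option.sel)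
  next
    case False
    \<comment> \<open>If \<open>a\<close> and \<open>b\<close> were both leaves of \<open>M\<close>,
      any non-leaf among \<open>c\<close> and \<open>d\<close> would be split off from them. So
      neither pair lies in \<open>M\<close>, and both get the root color 0.\<close>
    then have "\<not> (leaf M a \<and> leaf M b)" "\<not> (leaf M c \<and> leaf M d)"
      using not_C unfolding rooted_C_def by blast+
    then show ?thesis by (simp only: rooted_color_def if_False)
  qed
qed

sublocale tree: colored_C "rooted_C M" "rooted_color n M"
  by unfold_locales (fact C_set_rooted, fact rooted_color_branch)

abbreviation D where "D \<equiv> tree.D_of"
abbreviation t where "t \<equiv> tree.median_col"
abbreviation \<Omega> where "\<Omega> \<equiv> insert None (Some ` univ M)"
abbreviation M' where "M' \<equiv> D_extension n M"

lemma M'_simps: "sig M' = D_sig n" "univ M' = \<Omega>"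
  "rel M' Tree [w, x, y, z] \<longleftrightarrow> D w x y z"
  "rel M' (Color i) [x, y, z] \<longleftrightarrow> distinct [x, y, z] \<and> t x y z = i"
  by (simp_all add: D_extension_def numeral_eq_Suc)

lemma D_rel_M': "D_rel M' = D"
  by (simp add: D_rel_def M'_simps fun_eq_iff)

lemma D_None:
  assumes "x \<in> univ M" "y \<in> univ M" "z \<in> univ M"
  shows "D None (Some x) (Some y) (Some z) \<longleftrightarrow> C_rel M x y z"
proof -
  have "C_rel M x y y" if "x \<noteq> y" using C_set_M assms that unfolding C_set_def by blast
  then show ?thesis using assms by (auto simp: tree.D_of_def rooted_C_def)
qed

lemma t_None: "t (Some x) (Some y) None = rooted_color n M (Some x) (Some y)"
  by (simp add: tree.median_col_def rooted_C_def)

lemma t_rotate: "distinct [a, b, c] \<Longrightarrow> t a b c = t b c a"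
  using tree.t_swap12[of a b c] tree.t_swap23[of b a c] by auto

text \<open>The reserved color 0 never reaches a triple: rotation puts \<open>None\<close> last if
  it occurs, and \<open>t_by_base\<close> reduces the other triples to this case, where the color is
  that of two leaves of \<open>M\<close>.\<close>

lemma t_range:
  assumes "distinct [a, b, c]" "a \<in> \<Omega>" "b \<in> \<Omega>" "c \<in> \<Omega>"
  shows "t a b c \<in> {1..n}"
proof -
  have *: "t a b None \<in> {1..n}" if "a \<noteq> b" "a \<noteq> None" "b \<noteq> None" "a \<in> \<Omega>" "b \<in> \<Omega>" for a b
  proof -
    from that obtain x y where "a = Some x" "b = Some y" "x \<in> univ M" "y \<in> univ M" by blast
    then show ?thesis using that(1) rooted_color_Some(1)[of x y] by (simp add: t_None)
  qed
  show ?thesis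
  proof (cases "None \<in> {a, b, c}")
    case True
    then show ?thesis
      using assms *[of a b] *[of b c] *[of c a] t_rotate[of a b c] t_rotate[of b c a] by auto
  next
    case False
    then have "distinct [a, b, c, None]" using assms by auto
    note base = tree.t_by_base[OF this]
    have "t b c None \<in> {1..n}" "t a c None \<in> {1..n}" "t a b None \<in> {1..n}"
      by (rule *; use assms False in force)+
    then show ?thesis unfolding base by simp
  qed
qed

lemma Aut_M'_iff:
  "g \<in> Aut M' \<longleftrightarrow> g permutes \<Omega> \<and>
    (\<forall>w\<in>\<Omega>. \<forall>x\<in>\<Omega>. \<forall>y\<in>\<Omega>. \<forall>z\<in>\<Omega>. D (g w) (g x) (g y) (g z) \<longleftrightarrow> D w x y z) \<and>
    (\<forall>x\<in>\<Omega>. \<forall>y\<in>\<Omega>. \<forall>z\<in>\<Omega>. distinct [x, y, z] \<longrightarrow> t (g x) (g y) (g z) = t x y z)"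
    (is "_ \<longleftrightarrow> _ \<and> ?D \<and> ?t")
proof -
  have dest: "?D \<and> ?t" if "g permutes \<Omega>" and g: "\<forall>s. \<forall>xs \<in> tuples_of M' s. rel M' s (map g xs) \<longleftrightarrow> rel M' s xs"
  proof (intro conjI ballI impI)
    fix w x y z assume "w \<in> \<Omega>" "x \<in> \<Omega>" "y \<in> \<Omega>" "z \<in> \<Omega>"
    then have "[w, x, y, z] \<in> tuples_of M' Tree" by (simp add: tuples_of_def M'_simps D_sig_Some)
    from bspec[OF spec[OF g] this] show "D (g w) (g x) (g y) (g z) \<longleftrightarrow> D w x y z"
      by (simp add: M'_simps)
  next
    fix x y z assume xyz: "x \<in> \<Omega>" "y \<in> \<Omega>" "z \<in> \<Omega>" "distinct [x, y, z]"
    \<comment> \<open>The color of the triple is itself a symbol of the language by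
      \<open>t_range\<close>, so preservation of this one relation already yields equality of
      colors.\<close>
    then have "[x, y, z] \<in> tuples_of M' (Color (t x y z))"
      using t_range[of x y z] by (simp add: tuples_of_def M'_simps D_sig_Some)
    from bspec[OF spec[OF g] this] show "t (g x) (g y) (g z) = t x y z"
      using xyz(4) by (simp add: M'_simps)
  qed
  have intro: "rel M' s (map g xs) \<longleftrightarrow> rel M' s xs"
    if g: "g permutes \<Omega>" ?D ?t and xs: "xs \<in> tuples_of M' s" for s xs
  proof -
    have inj: "g x = g y \<longleftrightarrow> x = y" for x y using permutes_inj[OF g(1)] by (auto simp: inj_def)
    consider "s = Tree" "length xs = 4" | i where "s = Color i" "length xs = 3"
      using xs by (auto simp: tuples_of_def M'_simps D_sig_Some)
    then show ?thesis
    proof cases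
      case 1
      then obtain w x y z where "xs = [w, x, y, z]" by (auto simp: length_4_iff)
      moreover from this have "w \<in> \<Omega>" "x \<in> \<Omega>" "y \<in> \<Omega>" "z \<in> \<Omega>"
        using xs by (auto simp: tuples_of_def M'_simps)
      then have "D (g w) (g x) (g y) (g z) \<longleftrightarrow> D w x y z" using g(2) by blast
      ultimately show ?thesis using 1 by (simp add: M'_simps)
    next
      case 2
      then obtain x y z where "xs = [x, y, z]" by (auto simp: length_3_iff)
      moreover from this have "x \<in> \<Omega>" "y \<in> \<Omega>" "z \<in> \<Omega>"
        using xs by (auto simp: tuples_of_def M'_simps)
      then have "distinct [x, y, z] \<longrightarrow> t (g x) (g y) (g z) = t x y z" using g(3) by blast
      ultimately show ?thesis using 2 inj by (auto simp: M'_simps)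
    qed
  qed
  have Aut: "g \<in> Aut M' \<longleftrightarrow> g permutes \<Omega> \<and>
    (\<forall>s. \<forall>xs \<in> tuples_of M' s. rel M' s (map g xs) \<longleftrightarrow> rel M' s xs)"
    by (simp only: Aut_def mem_Collect_eq M'_simps(2))
  show ?thesis
    unfolding Aut
  proof
    assume g: "g permutes \<Omega> \<and> (\<forall>s. \<forall>xs \<in> tuples_of M' s. rel M' s (map g xs) \<longleftrightarrow> rel M' s xs)"
    from conjI[OF conjunct1[OF g] dest[OF conjunct1[OF g] conjunct2[OF g]]]
    show "g permutes \<Omega> \<and> ?D \<and> ?t" .
  next
    assume g: "g permutes \<Omega> \<and> ?D \<and> ?t"
    note * = conjunct1[OF g] conjunct1[OF conjunct2[OF g]] conjunct2[OF conjunct2[OF g]]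
    from *(1) intro[OF *]
    show "g permutes \<Omega> \<and> (\<forall>s. \<forall>xs \<in> tuples_of M' s. rel M' s (map g xs) \<longleftrightarrow> rel M' s xs)"
      by (intro conjI allI ballI)
  qed
qed

section \<open>Partial isomorphisms of the extension\<close>

definition partial_iso :: "('a option \<times> 'a option) set \<Rightarrow> bool" where
  "partial_iso R \<longleftrightarrow> R \<subseteq> \<Omega> \<times> \<Omega> \<and>
    (\<forall>a a' b b'. (a, a') \<in> R \<longrightarrow> (b, b') \<in> R \<longrightarrow> (a = b \<longleftrightarrow> a' = b')) \<and>
    (\<forall>a a' b b' c c' d d'. (a, a') \<in> R \<longrightarrow> (b, b') \<in> R \<longrightarrow> (c, c') \<in> R \<longrightarrow> (d, d') \<in> R \<longrightarrow>
      (D a b c d \<longleftrightarrow> D a' b' c' d')) \<and>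
    (\<forall>a a' b b' c c'. (a, a') \<in> R \<longrightarrow> (b, b') \<in> R \<longrightarrow> (c, c') \<in> R \<longrightarrow> distinct [a, b, c] \<longrightarrow>
      t a b c = t a' b' c')"

lemma
  assumes "partial_iso R"
  shows partial_iso_subset: "R \<subseteq> \<Omega> \<times> \<Omega>"
    and partial_iso_eq: "(a, a') \<in> R \<Longrightarrow> (b, b') \<in> R \<Longrightarrow> a = b \<longleftrightarrow> a' = b'"
    and partial_iso_D: "(a, a') \<in> R \<Longrightarrow> (b, b') \<in> R \<Longrightarrow> (c, c') \<in> R \<Longrightarrow> (d, d') \<in> R \<Longrightarrow>
      D a b c d \<longleftrightarrow> D a' b' c' d'"
    and partial_iso_t: "(a, a') \<in> R \<Longrightarrow> (b, b') \<in> R \<Longrightarrow> (c, c') \<in> R \<Longrightarrow> distinct [a, b, c] \<Longrightarrow>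
      t a b c = t a' b' c'"
  using assms unfolding partial_iso_def by blast+

text \<open>This is the reason for using relations instead of functions: enlarging the range becomes
  enlarging the domain of the converse.\<close>

lemma partial_iso_converse:
  assumes "partial_iso R"
  shows "partial_iso (R\<inverse>)"
proof -
  note E = partial_iso_eq[OF assms]
  have "t a b c = t a' b' c'" if "(a', a) \<in> R" "(b', b) \<in> R" "(c', c) \<in> R" "distinct [a, b, c]" for a b c a' b' c'
  proof -
    have "distinct [a', b', c']" using that E[OF that(1,2)] E[OF that(1,3)] E[OF that(2,3)] by simp
    then show ?thesis using partial_iso_t[OF assms that(1-3)] by simp
  qed
  then show ?thesis unfolding partial_iso_def
    using partial_iso_subset[OF assms] E partial_iso_D[OF assms] by blast
qed

lemma partial_iso_singleton:
  assumes "x \<in> \<Omega>" "y \<in> \<Omega>"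
  shows "partial_iso {(x, y)}"
  using assms tree.not_D_base unfolding partial_iso_def by auto

text \<open>Since both \<open>D\<close> and the colors are determined by what they say about tuples through a base
  point, it suffices to compare such tuples.\<close>

lemma partial_iso_based:
  assumes k: "inj_on k X" "X \<subseteq> \<Omega>" "k ` X \<subseteq> \<Omega>" "o' \<in> X"
    and D: "\<And>a b c. a \<in> X \<Longrightarrow> b \<in> X \<Longrightarrow> c \<in> X \<Longrightarrow> a \<noteq> o' \<Longrightarrow> b \<noteq> o' \<Longrightarrow> c \<noteq> o' \<Longrightarrow>
      D o' a b c \<longleftrightarrow> D (k o') (k a) (k b) (k c)"
    and t: "\<And>a b. a \<in> X \<Longrightarrow> b \<in> X \<Longrightarrow> distinct [a, b, o'] \<Longrightarrow> t a b o' = t (k a) (k b) (k o')"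
  shows "partial_iso {(a, k a) | a. a \<in> X}"
proof -
  have keq: "k a = k b \<longleftrightarrow> a = b" if "a \<in> X" "b \<in> X" for a b
    using k(1) that by (auto simp: inj_on_def)
  have D': "D o' a b c \<longleftrightarrow> D (k o') (k a) (k b) (k c)" if "a \<in> X" "b \<in> X" "c \<in> X" for a b c
  proof -
    \<comment> \<open>In the first three cases the base point is repeated, and both sides are
      decided by equalities, which the injective \<open>k\<close> preserves.\<close>
    consider "a = o'" | "b = o'" | "c = o'" | "a \<noteq> o'" "b \<noteq> o'" "c \<noteq> o'" by blast
    then show ?thesis
    proof cases
      case 1
      then show ?thesis using that k(4) by (simp add: tree.D_base_eq keq)
    next
      case 2
      then show ?thesis by (simp add: tree.not_D_base)
    next
      case 3
      then show ?thesis
        unfolding tree.D_swap2_iff[of o' a b c] tree.D_swap2_iff[of "k o'" "k a" "k b" "k c"]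
        by (simp add: tree.not_D_base)
    next
      case 4
      then show ?thesis using D that by blast
    qed
  qed
  have D4: "D w x y z \<longleftrightarrow> D (k w) (k x) (k y) (k z)" if "w \<in> X" "x \<in> X" "y \<in> X" "z \<in> X" for w x y z
    unfolding tree.D_by_base[of w x y z o'] tree.D_by_base[of "k w" "k x" "k y" "k z" "k o'"]
    using that D' by simp
  have t3: "t a b c = t (k a) (k b) (k c)" if "a \<in> X" "b \<in> X" "c \<in> X" and abc: "distinct [a, b, c]" for a b c
  proof -
    have kabc: "distinct [k a, k b, k c]" using that by (simp add: keq)
    note rot = t_rotate[OF abc] t_rotate[of b c a] t_rotate[OF kabc] t_rotate[of "k b" "k c" "k a"]
    consider "a = o'" | "b = o'" | "c = o'" | "a \<noteq> o'" "b \<noteq> o'" "c \<noteq> o'" by blast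
    then show ?thesis
    proof cases
      case 1
      then show ?thesis using that kabc rot t[of b c] by auto
    next
      case 2
      then show ?thesis using that kabc rot t[of c a] by auto
    next
      case 3
      then show ?thesis using that t[of a b] by auto
    next
      case 4
      then have d: "distinct [a, b, c, o']" "distinct [k a, k b, k c, k o']"
        using that kabc k(4) by (auto simp: keq)
      have e: "t b c o' = t (k b) (k c) (k o')" "t a c o' = t (k a) (k c) (k o')" "t a b o' = t (k a) (k b) (k o')"
        using t that d by simp_all
      show ?thesis
        unfolding tree.t_by_base[OF d(1)] tree.t_by_base[OF d(2)] e D'[OF that(1-3)] D'[OF that(2,1,3)] ..
    qed
  qed
  show ?thesis unfolding partial_iso_def
    using k(2,3) D4 t3 keq by auto
qed

text \<open>Re-rooting at \<open>o'\<close>. Removing \<open>o'\<close> from the carrier is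
  essential: (C4) becomes \<open>D o' a b b\<close>, which requires \<open>b\<close> to differ from
  \<open>o'\<close>, and the color \<open>t a b o'\<close> requires three distinct points.\<close>

lemma internally_colored_based:
  assumes "o' \<in> \<Omega>" "S \<subseteq> \<Omega> - {o'}"
  shows "internally_colored_C_set n \<lparr>sig = C_sig n, univ = S, rel = \<lambda>s xs. case s of
      Tree \<Rightarrow> D o' (xs ! 0) (xs ! 1) (xs ! 2)
    | Color i \<Rightarrow> xs ! 0 \<noteq> xs ! 1 \<and> t (xs ! 0) (xs ! 1) o' = i\<rparr>" (is "internally_colored_C_set n ?B")
  unfolding internally_colored_C_set_def
proof (intro conjI ballI impI)
  have C: "C_rel ?B = D o'" by (simp add: C_rel_def fun_eq_iff numeral_2_eq_2)
  have P: "rel ?B (Color i) [a, b] \<longleftrightarrow> a \<noteq> b \<and> t a b o' = i" for i a b by simp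
  show "C_set (univ ?B) (C_rel ?B)"
    unfolding C C_set_def
  proof (intro ballI conjI impI)
    fix a b c d assume "a \<in> univ ?B" "b \<in> univ ?B"
    then have "b \<noteq> o'" using assms by auto
    then show "D o' a b b" if "a \<noteq> b" using that by (simp add: tree.D_refl)
    assume abc: "D o' a b c"
    show "D o' a c b" using abc tree.D_swap2_iff by blast
    show "\<not> D o' b a c" using abc tree.D_excl by blast
    show "D o' a d c \<or> D o' d b c"
      using tree.D_point[of a o' c b d] abc tree.D_swap_iff tree.D_swap2_iff by blast
  qed
  show "colors_partition n 2 ?B"
    unfolding colors_partition_2 P
  proof (intro ballI)
    fix x y assume "x \<in> univ ?B" "y \<in> univ ?B"
    then have "x \<in> \<Omega>" "y \<in> \<Omega>" "x \<noteq> o'" "y \<noteq> o'" using assms by auto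
    then have "t x y o' \<in> {1..n}" if "x \<noteq> y" using that t_range[of x y o'] assms by simp
    then show "if x \<noteq> y then \<exists>!i. i \<in> {1..n} \<and> x \<noteq> y \<and> t x y o' = i
      else \<forall>i\<in>{1..n}. \<not> (x \<noteq> y \<and> t x y o' = i)" by auto
  qed
  fix a b c d i assume "a \<in> univ ?B" "b \<in> univ ?B" "c \<in> univ ?B" "d \<in> univ ?B"
    and sb: "same_branching_point (C_rel ?B) a b c d"
  then have "o' \<notin> {a, b, c, d}" using assms by auto
  then have "t a b o' = t c d o'" using sb tree.t_same_base unfolding C by blast
  moreover have "a \<noteq> b" "c \<noteq> d" using sb by (simp_all add: same_branching_point_def)
  ultimately show "rel ?B (Color i) [a, b] = rel ?B (Color i) [c, d]" unfolding P by simp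
qed simp

lemma partial_iso_extend:
  assumes R: "partial_iso R" "finite R" and "(o', None) \<in> R" and y: "y \<in> \<Omega>"
  shows "\<exists>z. partial_iso (insert (y, z) R)"
proof (cases "y \<in> Domain R")
  case True
  then obtain z where "(y, z) \<in> R" by blast
  then show ?thesis using R(1) insert_absorb by metis
next
  case False
  \<comment> \<open>For \<open>a\<close> in \<open>Y\<close> the partner is unique and differs from
    \<open>None\<close>, because only \<open>o'\<close> is related to \<open>None\<close>; hence
    \<open>the\<close> returns a genuine point of \<open>M\<close>.\<close>
  define f where "f a = the (SOME a'. (a, a') \<in> R)" for a
  define Y where "Y = Domain R - {o'}"
  define S where "S = insert y Y"
  have o: "o' \<in> \<Omega>" "y \<noteq> o'" using assms partial_iso_subset[OF R(1)] False by auto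
  have RY: "(a, Some (f a)) \<in> R" "f a \<in> univ M" if "a \<in> Y" for a
  proof -
    have *: "(a, SOME a'. (a, a') \<in> R) \<in> R" using that by (auto simp: Y_def intro: someI)
    moreover have "(SOME a'. (a, a') \<in> R) \<noteq> None"
      using partial_iso_eq[OF R(1) * assms(3)] that by (simp add: Y_def)
    ultimately show "(a, Some (f a)) \<in> R" by (auto simp: f_def)
    then show "f a \<in> univ M" using partial_iso_subset[OF R(1)] by auto
  qed
  have S: "S \<subseteq> \<Omega> - {o'}" "finite S"
    using partial_iso_subset[OF R(1)] y o R(2) by (auto simp: S_def Y_def finite_Domain)
  define B where "B = \<lparr>sig = C_sig n, univ = S, rel = \<lambda>s xs. case s of
      Tree \<Rightarrow> D o' (xs ! 0) (xs ! 1) (xs ! 2)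
    | Color i \<Rightarrow> xs ! 0 \<noteq> xs ! 1 \<and> t (xs ! 0) (xs ! 1) o' = i\<rparr>"
  have B: "internally_colored_C_set n B" "finite (univ B)"
    using internally_colored_based[OF o(1) S(1)] S(2) by (simp_all add: B_def)
  have B_simps: "univ B = S" "sig B = C_sig n" "C_rel B a b c \<longleftrightarrow> D o' a b c"
    "rel B (Color i) [a, b] \<longleftrightarrow> a \<noteq> b \<and> t a b o' = i" for i a b c
    by (simp_all add: B_def C_rel_def numeral_2_eq_2)
  have C_rel_sub: "C_rel (substruct B Y) = C_rel B" by (simp add: C_rel_def fun_eq_iff)
  have color_iff: "rel M (Color i) [x, z] \<longleftrightarrow> x \<noteq> z \<and> t (Some x) (Some z) None = i"
    if "x \<in> univ M" "z \<in> univ M" "i \<in> {1..n}" for x z i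
    using that rooted_color_Some(2)[of x z i] not_color_same[of x i] unfolding t_None by blast
  \<comment> \<open>As \<open>o'\<close> is related to \<open>None\<close>, \<open>R\<close> turns
    the relations based at \<open>o'\<close> into those based at \<open>None\<close>, and on leaves
    these are the relations of \<open>M\<close> (\<open>D_None\<close>,
    \<open>t_None\<close>).\<close>
  have "embedding f (substruct B Y) M"
  proof (rule embedding_C_I)
    show "sig (substruct B Y) = C_sig n" "sig M = C_sig n" by (simp_all add: B_simps sig_M)
    have f_eq: "f a = f b \<longleftrightarrow> a = b" if "a \<in> Y" "b \<in> Y" for a b
      using partial_iso_eq[OF R(1) RY(1)[OF that(1)] RY(1)[OF that(2)]] by simp
    then show "inj_on f (univ (substruct B Y))" by (simp add: inj_on_def)
    show "f ` univ (substruct B Y) \<subseteq> univ M" using RY(2) by auto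
    show "C_rel M (f a) (f b) (f c) = C_rel (substruct B Y) a b c"
      if "a \<in> univ (substruct B Y)" "b \<in> univ (substruct B Y)" "c \<in> univ (substruct B Y)" for a b c
      using that partial_iso_D[OF R(1) assms(3) RY(1) RY(1) RY(1), of a b c] RY(2)
      by (simp add: C_rel_sub B_simps D_None)
    show "rel M (Color i) [f a, f b] = rel (substruct B Y) (Color i) [a, b]"
      if "a \<in> univ (substruct B Y)" "b \<in> univ (substruct B Y)" "i \<in> {1..n}" for a b i
    proof -
      have ab: "a \<in> Y" "b \<in> Y" using that by simp_all
      have "t a b o' = t (Some (f a)) (Some (f b)) None" if "a \<noteq> b"
        using ab that partial_iso_t[OF R(1) RY(1)[OF ab(1)] RY(1)[OF ab(2)] assms(3)] by (simp add: Y_def)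
      then show ?thesis
        using color_iff[OF RY(2)[OF ab(1)] RY(2)[OF ab(2)] that(3)] f_eq[OF ab] by (auto simp: B_simps)
    qed
  qed
  moreover have "Y \<subseteq> univ B" by (auto simp: B_simps S_def)
  ultimately obtain g where g: "embedding g B M" "\<And>a. a \<in> Y \<Longrightarrow> g a = f a"
    using generic_extension[OF generic B] by metis
  have gM: "g a \<in> univ M" if "a \<in> S" for a using embedding_range[OF g(1)] that by (auto simp: B_simps)
  define k where "k a = (if a = o' then None else Some (g a))" for a
  define X where "X = insert o' S"
  have "partial_iso {(a, k a) | a. a \<in> X}"
  proof (rule partial_iso_based)
    show "inj_on k X"
      using embedding_inj[OF g(1)] by (auto simp: X_def B_simps k_def inj_on_def)
    show "X \<subseteq> \<Omega>" "o' \<in> X" using S o by (auto simp: X_def)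
    show "k ` X \<subseteq> \<Omega>" using gM by (auto simp: k_def X_def)
    fix a b assume ab: "a \<in> X" "b \<in> X"
    show "D o' a b c = D (k o') (k a) (k b) (k c)" if c: "c \<in> X" and ne: "a \<noteq> o'" "b \<noteq> o'" "c \<noteq> o'" for c
    proof -
      have "a \<in> S" "b \<in> S" "c \<in> S" using ab c ne by (simp_all add: X_def)
      then show ?thesis
        using embedding_rel[OF g(1), of "[a, b, c]" Tree] ne
        by (simp add: B_simps k_def D_None gM flip: C_rel_def)
    qed
    assume d: "distinct [a, b, o']"
    then have S: "a \<in> S" "b \<in> S" using ab by (simp_all add: X_def)
    have "t a b o' \<in> {1..n}" using t_range[OF d] ab \<open>X \<subseteq> \<Omega>\<close> o by blast
    then show "t a b o' = t (k a) (k b) (k o')"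
      using embedding_rel[OF g(1), of "[a, b]" "Color (t a b o')"] S d color_iff[OF gM gM, of a b "t a b o'"]
      by (simp add: B_simps k_def)
  qed
  \<comment> \<open>Since \<open>g\<close> extends \<open>f\<close> and \<open>k o'\<close> is
    \<open>None\<close>, the graph of \<open>k\<close> is \<open>R\<close> itself with one pair
    added.\<close>
  moreover have "insert (y, Some (g y)) R = {(a, k a) | a. a \<in> X}" (is "?R = ?K")
  proof
    have "a' = k a \<and> a \<in> X" if "(a, a') \<in> R" for a a'
    proof (cases "a = o'")
      case True
      then show ?thesis using partial_iso_eq[OF R(1) that assms(3)] by (simp add: k_def X_def)
    next
      case False
      then have "a \<in> Y" using that by (auto simp: Y_def)
      then show ?thesis
        using partial_iso_eq[OF R(1) that RY(1)[of a]] False g(2) by (simp add: k_def X_def S_def)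
    qed
    moreover have "Some (g y) = k y \<and> y \<in> X" using o by (simp add: k_def X_def S_def)
    ultimately show "?R \<subseteq> ?K" by (intro subrelI) blast
    have "(a, k a) \<in> ?R" if "a \<in> X" for a
    proof -
      from that consider "a = o'" | "a = y" "a \<noteq> o'" | "a \<in> Y" "a \<noteq> o'"
        by (auto simp: X_def S_def)
      then show ?thesis by cases (use assms(3) RY(1) g(2) in \<open>simp_all add: k_def\<close>)
    qed
    then show "?K \<subseteq> ?R" by blast
  qed
  ultimately show ?thesis by metis
qed

section \<open>Transitivity\<close>

lemma Aut_moves_to_None:
  assumes "x \<in> \<Omega>"
  shows "\<exists>g\<in>Aut M'. g None = x"
proof -
  \<comment> \<open>\<open>None\<close> in the range supplies the base point that
    \<open>partial_iso_extend\<close> asks for; \<open>None\<close> in the domain supplies it for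
    the converse, hence for \<open>backward\<close>.\<close>
  define G where "G R \<longleftrightarrow> partial_iso R \<and> finite R \<and> None \<in> Domain R \<and> None \<in> Range R" for R
  have G_conv: "G (R\<inverse>) \<longleftrightarrow> G R" for R
    using partial_iso_converse[of R] partial_iso_converse[of "R\<inverse>"] by (auto simp: G_def)
  have forward: "\<exists>z. G (insert (y, z) R)" if GR: "G R" and y: "y \<in> \<Omega>" for R y
  proof -
    obtain o' where "(o', None) \<in> R" using GR by (auto simp: G_def)
    then obtain z where "partial_iso (insert (y, z) R)"
      using partial_iso_extend y GR unfolding G_def by blast
    then show ?thesis using GR by (auto simp: G_def)
  qed
  have backward: "\<exists>y. G (insert (y, z) R)" if "G R" and z: "z \<in> \<Omega>" for R z
  proof -
    have "G (R\<inverse>)" using that G_conv by blast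
    then obtain y where "G (insert (z, y) (R\<inverse>))" using forward z by blast
    moreover have "(insert (y, z) R)\<inverse> = insert (z, y) (R\<inverse>)" by auto
    ultimately show ?thesis using G_conv by metis
  qed
  obtain z where "partial_iso (insert (None, z) {(x, None)})"
    using partial_iso_extend[OF partial_iso_singleton[of x None], of x None] assms by auto
  then have "G {(None, z), (x, None)}" by (auto simp: G_def)
  moreover have "{(None, z), (x, None)}\<inverse> = {(None, x), (z, None)}" by auto
  ultimately have "G {(None, x), (z, None)}" using G_conv by metis
  moreover have "countable \<Omega>" using countable_M by simp
  ultimately obtain U where U: "{(None, x), (z, None)} \<subseteq> U" "\<Omega> \<subseteq> Domain U" "\<Omega> \<subseteq> Range U"
    and loc: "\<And>F. finite F \<Longrightarrow> F \<subseteq> U \<Longrightarrow> \<exists>R. G R \<and> F \<subseteq> R"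
    using back_and_forth[of \<Omega> G, OF _ _ _ forward backward] by (metis insert_not_empty)
  have loc: "\<exists>R. partial_iso R \<and> F \<subseteq> R" if "finite F" "F \<subseteq> U" for F
    using loc[OF that] by (auto simp: G_def)
  \<comment> \<open>Each clause involves at most four pairs, and those lie together in one finite
    partial isomorphism.\<close>
  have "partial_iso U"
    unfolding partial_iso_def
  proof (intro conjI allI impI)
    show "U \<subseteq> \<Omega> \<times> \<Omega>"
    proof
      fix p assume "p \<in> U"
      then obtain R where "partial_iso R" "p \<in> R" using loc[of "{p}"] by auto
      then show "p \<in> \<Omega> \<times> \<Omega>" using partial_iso_subset by blast
    qed
    fix a a' b b' assume ab: "(a, a') \<in> U" "(b, b') \<in> U"
    then obtain R where "partial_iso R" "{(a, a'), (b, b')} \<subseteq> R" using loc[of "{(a, a'), (b, b')}"] by auto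
    then show "a = b \<longleftrightarrow> a' = b'" using partial_iso_eq by simp
    fix c c' assume c: "(c, c') \<in> U"
    show "D a b c d \<longleftrightarrow> D a' b' c' d'" if d: "(d, d') \<in> U" for d d'
    proof -
      obtain R where "partial_iso R" "{(a, a'), (b, b'), (c, c'), (d, d')} \<subseteq> R"
        using loc[of "{(a, a'), (b, b'), (c, c'), (d, d')}"] ab c d by auto
      then show ?thesis using partial_iso_D by simp
    qed
    show "t a b c = t a' b' c'" if "distinct [a, b, c]"
    proof -
      obtain R where "partial_iso R" "{(a, a'), (b, b'), (c, c')} \<subseteq> R"
        using loc[of "{(a, a'), (b, b'), (c, c')}"] ab c by auto
      then show ?thesis using partial_iso_t[of R a a' b b' c c'] that by simp
    qed
  qed
  \<comment> \<open>The value in \<open>\<Omega>\<close> is unique by \<open>partial_iso_eq\<close>;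
    outside, \<open>permutes\<close> demands the identity.\<close>
  define g where "g a = (if a \<in> \<Omega> then SOME a'. (a, a') \<in> U else a)" for a
  have gU: "(a, g a) \<in> U" if "a \<in> \<Omega>" for a
  proof -
    have "\<exists>a'. (a, a') \<in> U" using U(2) that by blast
    then show ?thesis using that someI_ex by (simp add: g_def)
  qed
  have U_mem: "a \<in> \<Omega>" "b \<in> \<Omega>" if "(a, b) \<in> U" for a b
    using subsetD[OF partial_iso_subset[OF \<open>partial_iso U\<close>] that] by (rule SigmaD1, rule SigmaD2)
  have g_eq: "g a = b" if "(a, b) \<in> U" for a b
    using partial_iso_eq[OF \<open>partial_iso U\<close> gU[OF U_mem(1)[OF that]] that] by (rule iffD1) (rule refl)
  have "bij_betw g \<Omega> \<Omega>"
  proof (rule bij_betw_imageI)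
    show "inj_on g \<Omega>"
      using partial_iso_eq[OF \<open>partial_iso U\<close> gU gU] by (intro inj_onI) blast
    show "g ` \<Omega> = \<Omega>"
    proof (intro equalityI subsetI)
      show "b \<in> \<Omega>" if "b \<in> g ` \<Omega>" for b
        using that by (elim imageE) (simp only: U_mem(2)[OF gU])
      fix b assume "b \<in> \<Omega>"
      then have "b \<in> Range U" by (rule subsetD[OF U(3)])
      then obtain a where "(a, b) \<in> U" by (elim RangeE)
      with g_eq U_mem(1) show "b \<in> g ` \<Omega>" by (metis imageI)
    qed
  qed
  then have "g permutes \<Omega>" by (rule bij_imp_permutes) (simp only: g_def if_False)
  then have "g \<in> Aut M'"
    unfolding Aut_M'_iff
    using partial_iso_D[OF \<open>partial_iso U\<close> gU gU gU gU] partial_iso_t[OF \<open>partial_iso U\<close> gU gU gU]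
    by (intro conjI ballI impI) (assumption | simp only:)+
  moreover have "g None = x" using U(1) by (intro g_eq) simp
  ultimately show ?thesis by (intro bexI)
qed

lemma transitive:
  assumes "x \<in> \<Omega>" "y \<in> \<Omega>"
  shows "\<exists>g\<in>Aut M'. g x = y"
proof -
  obtain g h where gh: "g \<in> Aut M'" "g None = x" "h \<in> Aut M'" "h None = y"
    using Aut_moves_to_None assms by metis
  then have "inv g x = None"
    by (metis Aut_iff permutes_inverses(2))
  then have "(h \<circ> inv g) x = y" using gh by simp
  then show ?thesis using Aut_comp[OF gh(3) Aut_inv[OF gh(1)]] by blast
qed

section \<open>Canonical form and the axioms of internally colored D-sets\<close>

lemma canonical: "canonical_form zero_pos M M'"
  unfolding canonical_form_def
proof (intro conjI allI ballI)
  fix s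
  show "sig M' s = map_option Suc (sig M s)"
    by (cases s) (simp_all add: M'_simps sig_M D_sig_def C_sig_def)
  fix xs assume xs: "xs \<in> tuples_of M s"
  then consider "s = Tree" "length xs = 3" | i where "i \<in> {1..n}" "s = Color i" "length xs = 2"
    by (auto simp: tuples_of_def sig_M C_sig_Some)
  then show "rel M s xs \<longleftrightarrow> rel M' s (insert_at (zero_pos s) None (map Some xs))"
  proof cases
    case 1
    then obtain x y z where "xs = [x, y, z]" by (auto simp: length_3_iff)
    then show ?thesis
      using 1 xs D_None[of x y z] by (simp add: M'_simps insert_at_def zero_pos_def tuples_of_def C_rel_def)
  next
    case 2
    then obtain x y where "xs = [x, y]" by (auto simp: length_2_iff)
    then show ?thesis
      using 2 xs rooted_color_Some(2)[of x y i] not_color_same[of x i]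
      by (auto simp: M'_simps insert_at_def zero_pos_def tuples_of_def t_None)
  qed
qed

lemma internally_colored_D: "internally_colored_D_set n M'"
  unfolding internally_colored_D_set_def D_rel_M' M'_simps(1,2)
proof (intro conjI allI impI)
  show "D_set \<Omega> D"
    unfolding D_set_def
  proof (intro ballI conjI impI)
    fix w x y z
    show "D w x y y" if "w \<noteq> y \<and> x \<noteq> y" using that by (simp add: tree.D_refl)
    assume "D w x y z"
    then show "D x w y z" "D y z w x" "\<not> D w y x z" "D v x y z \<or> D w x y v" for v
      by (rule tree.D_swap tree.D_sym tree.D_excl tree.D_point)+
  qed
  show "colors_partition n 3 M'"
    unfolding colors_partition_def
  proof (intro allI impI)
    fix xs assume "set xs \<subseteq> univ M' \<and> length xs = 3"
    then obtain x y z where xs: "xs = [x, y, z]" and \<Omega>: "x \<in> \<Omega>" "y \<in> \<Omega>" "z \<in> \<Omega>"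
      by (auto simp: length_3_iff M'_simps(2))
    then have "t x y z \<in> {1..n}" if "distinct xs" using that t_range by blast
    then show "if distinct xs then \<exists>!i. i \<in> {1..n} \<and> rel M' (Color i) xs
      else \<forall>i\<in>{1..n}. \<not> rel M' (Color i) xs"
      unfolding xs M'_simps(4) by (cases "distinct [x, y, z]") auto
  qed
  fix \<D> assume split: "splitting \<Omega> D \<D>"
  then have part: "partition_on \<Omega> \<D>" and "infinite \<D> \<or> 3 \<le> card \<D>"
    by (simp_all add: splitting_def)
  \<comment> \<open>Three sectors provide a triple branching at \<open>\<D>\<close>. Its color is
    the witness, and its existence keeps the condition on \<open>i\<close> from being vacuous, which
    gives uniqueness.\<close>
  then obtain T where "T \<subseteq> \<D>" "card T = 3"
    by (metis infinite_arbitrarily_large obtain_subset_with_card_n)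
  then obtain A B C where ABC: "A \<in> \<D>" "B \<in> \<D>" "C \<in> \<D>" "distinct [A, B, C]"
    by (auto simp: card_3_iff)
  moreover from this obtain a b c where abc: "a \<in> A" "b \<in> B" "c \<in> C"
    using partition_onD3[OF part] by (metis ex_in_conv)
  ultimately have bp: "is_branching_point \<Omega> D \<D> a b c"
    using split unfolding is_branching_point_def by blast
  have distinct: "distinct [x, y, z] \<and> {x, y, z} \<subseteq> \<Omega>" if "is_branching_point \<Omega> D \<D> x y z" for x y z
    using that partition_onD1[OF part] partition_onD2[OF part]
    unfolding is_branching_point_def by (auto simp: disjoint_def)
  show "\<exists>!i. i \<in> {1..n} \<and> (\<forall>x y z. is_branching_point \<Omega> D \<D> x y z \<longrightarrow> rel M' (Color i) [x, y, z])"
  proof (rule ex1I)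
    have "t a b c \<in> {1..n}" using distinct[OF bp] t_range by simp
    moreover have "rel M' (Color (t a b c)) [x, y, z]" if "is_branching_point \<Omega> D \<D> x y z" for x y z
      using that distinct tree.t_splitting[OF split that bp] by (simp add: M'_simps)
    ultimately show "t a b c \<in> {1..n} \<and>
      (\<forall>x y z. is_branching_point \<Omega> D \<D> x y z \<longrightarrow> rel M' (Color (t a b c)) [x, y, z])" by blast
    show "i = t a b c" if "i \<in> {1..n} \<and>
      (\<forall>x y z. is_branching_point \<Omega> D \<D> x y z \<longrightarrow> rel M' (Color i) [x, y, z])" for i
      using that bp unfolding M'_simps(4) by blast
  qed
qed (rule refl)

section \<open>The stabilizer of the new point\<close>

lemma leaf_map_option:
  assumes "g permutes univ M"
  shows "leaf M (map_option g a) \<longleftrightarrow> leaf M a"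
  using permutes_in_image[OF assms] by (cases a) simp_all

text \<open>\<open>D\<close> and \<open>t\<close> are built from \<open>rooted_C\<close> and
  \<open>rooted_color\<close>, which are defined from \<open>M\<close> alone and are therefore
  invariant, even on points outside \<open>\<Omega>\<close>.\<close>

lemma map_option_Aut:
  assumes g: "g \<in> Aut M"
  shows "map_option g \<in> Aut M'"
proof -
  let ?g = "map_option g"
  have perm: "g permutes univ M" and emb: "embedding g M M" using g by (simp_all add: Aut_iff)
  have inj: "?g x = ?g y \<longleftrightarrow> x = y" for x y
    using option.inj_map[OF permutes_inj[OF perm]] by (auto simp: inj_def)
  have leaf: "leaf M (?g x) \<longleftrightarrow> leaf M x" and the: "leaf M x \<Longrightarrow> the (?g x) = g (the x)"
    "leaf M x \<Longrightarrow> the x \<in> univ M" for x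
    using leaf_map_option[OF perm] by (auto simp: leaf_def)
  have C: "rooted_C M (?g x) (?g y) (?g z) \<longleftrightarrow> rooted_C M x y z" for x y z
  proof -
    have "C_rel M (the (?g x)) (the (?g y)) (the (?g z)) \<longleftrightarrow> C_rel M (the x) (the y) (the z)"
      if "leaf M x" "leaf M y" "leaf M z"
      using embedding_rel[OF emb, of "[the x, the y, the z]" Tree] that
      by (simp add: the sig_M C_rel_def)
    then show ?thesis unfolding rooted_C_def leaf inj by blast
  qed
  have col: "rooted_color n M (?g x) (?g y) = rooted_color n M x y" for x y
  proof (cases "leaf M x \<and> leaf M y")
    case True
    then have "(\<lambda>i. i \<in> {1..n} \<and> rel M (Color i) [the (?g x), the (?g y)]) =
      (\<lambda>i. i \<in> {1..n} \<and> rel M (Color i) [the x, the y])"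
      using embedding_rel[OF emb, of "[the x, the y]"] by (auto simp: the sig_M)
    then show ?thesis unfolding rooted_color_def leaf by (simp only:)
  next
    case False
    then show ?thesis unfolding rooted_color_def leaf by (simp only: if_False)
  qed
  have "?g permutes \<Omega>"
  proof (rule bij_imp_permutes)
    have "?g ` \<Omega> = insert None (Some ` g ` univ M)" by (auto simp: image_iff)
    then have "?g ` \<Omega> = \<Omega>" by (simp only: permutes_image[OF perm])
    then show "bij_betw ?g \<Omega> \<Omega>" using inj by (auto simp: bij_betw_def inj_on_def)
    show "?g x = x" if "x \<notin> \<Omega>" for x
      using that permutes_not_in[OF perm] by (cases x) auto
  qed
  then show ?thesis unfolding Aut_M'_iff tree.D_of_def tree.median_col_def C col by blast
qed

text \<open>Conversely, a permutation that fixes \<open>None\<close> and preserves \<open>D\<close>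
  and \<open>t\<close> preserves their instances at \<open>None\<close>, which are the relation
  \<open>C\<close> and the colors of \<open>M\<close>.\<close>

lemma Aut_M'_fixing_None:
  assumes g: "g \<in> Aut M'" "g None = None"
  shows "g \<in> map_option ` Aut M"
proof -
  \<comment> \<open>By injectivity only \<open>None\<close> is mapped to \<open>None\<close>, so
    \<open>the\<close> is applied to values of the form \<open>Some\<close>.\<close>
  define f where "f x = the (g (Some x))" for x
  have perm: "g permutes \<Omega>" using g(1) unfolding Aut_M'_iff by blast
  have inj: "g x = g y \<longleftrightarrow> x = y" for x y using permutes_inj[OF perm] by (auto simp: inj_def)
  have g_Some: "g (Some x) = Some (f x)" for x
    using inj[of "Some x" None] g(2) by (auto simp: f_def)
  have f_univ: "f x \<in> univ M \<longleftrightarrow> x \<in> univ M" for x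
    using permutes_in_image[OF perm, of "Some x"] by (auto simp: g_Some)
  have "f permutes univ M"
  proof (rule bij_imp_permutes)
    have "y \<in> f ` univ M" if "y \<in> univ M" for y
    proof -
      obtain z where z: "g z = Some y" using permutes_surj[OF perm] by (metis surjD)
      then obtain x where "z = Some x" using g(2) by (cases z) auto
      then show ?thesis using z that g_Some f_univ by auto
    qed
    then have "f ` univ M = univ M" using f_univ by blast
    moreover have "inj f" using inj g_Some by (metis injI option.inject)
    ultimately show "bij_betw f (univ M) (univ M)" by (auto simp: bij_betw_def inj_on_def)
    show "f x = x" if "x \<notin> univ M" for x
      using that permutes_not_in[OF perm, of "Some x"] g_Some by auto
  qed
  moreover have "embedding f M M"
  proof (rule embedding_C_I)
    show "sig M = C_sig n" "sig M = C_sig n" by (fact sig_M)+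
    show "inj_on f (univ M)" "f ` univ M \<subseteq> univ M"
      using \<open>f permutes univ M\<close> by (simp_all add: permutes_inj_on permutes_image)
    have mem: "None \<in> \<Omega>" "x \<in> univ M \<Longrightarrow> Some x \<in> \<Omega>" for x by simp_all
    show "C_rel M (f x) (f y) (f z) = C_rel M x y z"
      if "x \<in> univ M" "y \<in> univ M" "z \<in> univ M" for x y z
    proof -
      have "D (g None) (g (Some x)) (g (Some y)) (g (Some z)) \<longleftrightarrow> D None (Some x) (Some y) (Some z)"
        using g(1) mem that unfolding Aut_M'_iff by blast
      then show ?thesis using that by (simp add: g(2) g_Some D_None f_univ)
    qed
    show "rel M (Color i) [f x, f y] = rel M (Color i) [x, y]"
      if "x \<in> univ M" "y \<in> univ M" "i \<in> {1..n}" for x y i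
    proof (cases "x = y")
      case True
      then show ?thesis using that not_color_same f_univ by simp
    next
      case False
      then have "distinct [Some x, Some y, None]" by simp
      then have "t (g (Some x)) (g (Some y)) (g None) = t (Some x) (Some y) None"
        using g(1) mem that unfolding Aut_M'_iff by blast
      moreover have "f x \<noteq> f y" using False inj[of "Some x" "Some y"] by (simp add: g_Some)
      ultimately show ?thesis
        using that False rooted_color_Some(2)[of x y i] rooted_color_Some(2)[of "f x" "f y" i]
        by (simp add: g(2) g_Some t_None f_univ)
    qed
  qed
  moreover have "g = map_option f"
  proof
    show "g x = map_option f x" for x using g(2) g_Some by (cases x) simp_all
  qed
  ultimately show ?thesis by (simp add: Aut_iff)
qed

lemma one_point: "one_point_extension M M'"
  unfolding one_point_extension_def M'_simps(2)
  using map_option_Aut Aut_M'_fixing_None by auto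

lemma transitive_extension: "transitive_extension M M'"
  unfolding transitive_extension_def M'_simps(2) using one_point transitive by blast

end

theorem proposition6p13:
  fixes n :: nat and M :: "(sym, 'a) struct"
  assumes "1 \<le> n"
    and "generic_internally_colored_C_set n M"
  shows "\<exists>M' :: (sym, 'a option) struct.
    transitive_extension M M' \<and> canonical_form zero_pos M M' \<and> internally_colored_D_set n M'"
proof -
  interpret generic_C_set n M using assms(2) by unfold_locales
  show ?thesis using transitive_extension canonical internally_colored_D by blast
qed

end
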